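(* Let $\kappa := 1/\log(10^4)$ and let $k$ be an integer with $2 \leq k \leq \kappa \log \log n$. Define $\tilde{\delta}_k := 1/2$ and $\tilde{\delta}_i := 2^{-0.5 (\log n)^{(k-i)/k}}$ for $1 \leq i < k$, and let each $\delta_i$ be $\tilde{\delta}_i$ rounded up to the nearest multiple of $1/n$. Then the process $\mathrm{Quantile}(\delta_1, \ldots, \delta_k)$ on $n$ bins satisfies, for any $m \geq 1$, \[ \Pr\big[\mathrm{Gap}(m) \leq 1000 \cdot k \cdot (\log n)^{1/k}\big] \geq 1 - n^{-3}. \]
   Context: Balls are allocated sequentially into $n$ bins, starting from all loads $0$. Let $x_i^{(t)}$ be the load of bin $i$ after $t$ balls and $\mathrm{Gap}(t) := \max_i x_i^{(t)} - t/n$. Let $\mathrm{Rank}^{(t)}$ order bins by non-increasing current load (rank $1$ = most loaded; ties broken arbitrarily). The $k$-quantile process $\mathrm{Quantile}(\delta_1, \ldots, \delta_k)$ with fixed quantiles $0 < \delta_1 < \cdots < \delta_k < 1$ (multiples of $1/n$) works as follows: at each step, two bins are sampled independently and uniformly at random (with replacement); each sampled bin $j$ is assigned the index $\ell(j) \in \{0, \ldots, k\}$ such that $\mathrm{Rank}(j) \in (\delta_{\ell} n, \delta_{\ell+1} n]$, where $\delta_0 = 0$, $\delta_{k+1} = 1$; the ball is placed into the bin with the larger index (the one in a lighter rank class), ties broken uniformly at random. Equivalently, the ball goes to the bin of rank $i$ with probability $\delta_1/n$ for $i \leq \delta_1 n$, $(\delta_{j-1}+\delta_j)/n$ for $\delta_{j-1}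 n < i \leq \delta_j n$, and $(1+\delta_k)/n$ for $i > \delta_k n$. As throughout the paper, $n$ is assumed sufficiently large. *)

theory Defs
  imports "HOL-Probability.Probability"
begin

text \<open>
  The bins are \<open>1, ..., n\<close>. A history is the list of the bins that received the balls
  so far, most recent ball first, so the load of bin \<open>i\<close> is \<open>count_list h i\<close> and the
  number of balls is \<open>length h\<close>.
\<close>

definition gap :: "nat \<Rightarrow> nat list \<Rightarrow> real" where
  "gap n h = real (Max ((\<lambda>i. count_list h i) ` {1..n})) - real (length h) / real n"

definition is_ranking :: "nat \<Rightarrow> (nat \<Rightarrow> nat) \<Rightarrow> (nat \<Rightarrow> nat) \<Rightarrow> bool" where
  "is_ranking n x rk \<longleftrightarrow>
     bij_betw rk {1..n} {1..n} \<and>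
     (\<forall>i\<in>{1..n}. \<forall>j\<in>{1..n}. x i > x j \<longrightarrow> rk i < rk j)"

text \<open>
  Arbitrary tie-breaking: the ranking used for the next ball may depend on the whole
  history and may be randomised (independently of the two bins sampled for that ball).
\<close>

definition ranking_rule :: "nat \<Rightarrow> (nat list \<Rightarrow> (nat \<Rightarrow> nat) pmf) \<Rightarrow> bool" where
  "ranking_rule n R \<longleftrightarrow> (\<forall>h. \<forall>rk\<in>set_pmf (R h). is_ranking n (count_list h) rk)"

text \<open>
  Only \<open>\<delta> 1, ..., \<delta> k\<close> are used; the conventions \<open>\<delta> 0 = 0\<close> and \<open>\<delta> (k + 1) = 1\<close> are
  built in.
\<close>

definition quantile_bound :: "nat \<Rightarrow> (nat \<Rightarrow> real) \<Rightarrow> nat \<Rightarrow> real" where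
  "quantile_bound k \<delta> l = (if l = 0 then 0 else if l \<le> k then \<delta> l else 1)"

definition quantile_index :: "nat \<Rightarrow> nat \<Rightarrow> (nat \<Rightarrow> real) \<Rightarrow> nat \<Rightarrow> nat" where
  "quantile_index n k \<delta> r =
     (THE l. l \<le> k \<and> real r \<in> {quantile_bound k \<delta> l * real n<..quantile_bound k \<delta> (l + 1) * real n})"

text \<open>If both samples are the same bin, \<open>{i, j}\<close> is a singleton and that bin is chosen.\<close>

definition quantile_step ::
  "nat \<Rightarrow> nat \<Rightarrow> (nat \<Rightarrow> real) \<Rightarrow> (nat \<Rightarrow> nat) \<Rightarrow> nat pmf" where
  "quantile_step n k \<delta> rk =
     do {
       i \<leftarrow> pmf_of_set {1..n};
       j \<leftarrow> pmf_of_set {1..n};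
       let li = quantile_index n k \<delta> (rk i);
       let lj = quantile_index n k \<delta> (rk j);
       if li > lj then return_pmf i
       else if li < lj then return_pmf j
       else pmf_of_set {i, j}
     }"

primrec quantile_process ::
  "nat \<Rightarrow> nat \<Rightarrow> (nat \<Rightarrow> real) \<Rightarrow> (nat list \<Rightarrow> (nat \<Rightarrow> nat) pmf) \<Rightarrow> nat \<Rightarrow> nat list pmf" where
  "quantile_process n k \<delta> R 0 = return_pmf []"
| "quantile_process n k \<delta> R (Suc t) =
     do {
       h \<leftarrow> quantile_process n k \<delta> R t;
       rk \<leftarrow> R h;
       b \<leftarrow> quantile_step n k \<delta> rk;
       return_pmf (b # h)
     }"

definition \<kappa> :: real where
  "\<kappa> = 1 / ln (10 ^ 4)"

definition \<delta>_tilde :: "nat \<Rightarrow> nat \<Rightarrow> nat \<Rightarrow> real" where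
  "\<delta>_tilde n k i =
     (if i = k then 1 / 2
      else 2 powr (- 0.5 * ln (real n) powr ((real k - real i) / real k)))"

definition round_up :: "nat \<Rightarrow> real \<Rightarrow> real" where
  "round_up n x = real_of_int \<lceil>x * real n\<rceil> / real n"

end

theory Submission
  imports Defs
begin

text \<open>
  Everything follows from one Lyapunov function \<open>W\<close> of the normalised loads
  \<open>y i = x i - t / n\<close> with \<open>E W' \<le> (1 - \<Omega>(1 / n)) W + tiny\<close> in every state, so that \<open>E W\<close> is
  tiny at all times and Markov's inequality finishes the proof. Write \<open>L = (ln n)^(1/k)\<close>.

  Layer \<open>0\<close> is the two-sided exponential potential \<open>\<Phi> 0\<close> with a constant rate. Layer \<open>j \<ge> 1\<close> uses a
  potential \<open>\<Phi> j\<close> that grows at rate \<open>L ^ j / 4\<close> on an interval of length \<open>24 * L\<close> and at a small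
  constant rate above it. If \<open>\<Phi> (j - 1) = O(n)\<close>, then at most \<open>n * 2^(- L ^ j / 2)\<close> bins lie above
  the start of layer \<open>j\<close>, hence these bins all belong to the first \<open>k - j\<close> rank classes, receive balls
  at a rate negligible against \<open>exp (- L ^ j / 4)\<close>, and \<open>\<Phi> j\<close> contracts.

  To make this hold with overwhelming probability without conditioning on the past, \<open>\<Phi> j\<close> enters
  \<open>W\<close> through \<open>V j = min (exp (10 ln n / n * (\<Phi> j - 6 n))) (\<Phi> j / n)\<close>: a minimum contracts as soon as both of
  its arguments do. When \<open>\<Phi> (j - 1) > 7 n\<close>, the growth of \<open>V j\<close> is paid for by \<open>V (j - 1)\<close>, which is why
  the weights \<open>w j\<close> decrease rapidly in \<open>j\<close>. Loads beyond \<open>500 ln n\<close> are paid for by a two-sided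
  potential with a larger constant rate.
\<close>

text \<open>Neither branch of the minimum would do alone. \<Phi> j / n settles at a constant, which
  the huge weights of the lower layers would blow up, while the exponential branch can explode when
  layer j - 1 is bad. Together they give an equilibrium of about n^(-9), growth controlled by \<Phi>
  j / n, and from 7 n on the exact value \<Phi> j / n. A bad layer then has something to pay with,
  because \<Phi> j is at most exp (6 L^(j+1)) times \<Phi> (j - 1) in every state; this comparison
  is the reason for the slow rate above each layer. The last layer pays for nobody: its weight is
  about n^(-7), and a constant equilibrium is harmless there. The rate L^j / 4 is dictated by 1/4 <
  (ln 2)/2 < 1/2. At the start of layer j the potential of layer j - 1 has reached exp (L^j / 2) per
  bin, which forces the bins there into a class of relative size 2^(-L^j / 2); this scarcity has to
  beat the growth exp (L^j / 4) caused by one ball.\<close>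

definition shift :: "nat \<Rightarrow> (nat \<Rightarrow> real) \<Rightarrow> nat \<Rightarrow> nat \<Rightarrow> real" where
  "shift n y i = (\<lambda>j. y j + of_bool (j = i) - 1 / real n)"

definition potential :: "nat \<Rightarrow> (real \<Rightarrow> real) \<Rightarrow> (nat \<Rightarrow> real) \<Rightarrow> real" where
  "potential n \<phi> y = (\<Sum>j=1..n. \<phi> (y j))"

text \<open>One step is a deterministic drop of every load by 1/n followed by the rise of one bin by
  1. The rise is measured from the lowered load, so that the chosen bin does not enter
  \<open>decay\<close>.\<close>

definition jump :: "nat \<Rightarrow> (real \<Rightarrow> real) \<Rightarrow> real \<Rightarrow> real" where
  "jump n \<phi> x = \<phi> (x + 1 - 1 / real n) - \<phi> (x - 1 / real n)"

definition decay :: "nat \<Rightarrow> (real \<Rightarrow> real) \<Rightarrow> (nat \<Rightarrow> real) \<Rightarrow> real" where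
  "decay n \<phi> y = (\<Sum>j=1..n. \<phi> (y j) - \<phi> (y j - 1 / real n))"

definition prob_vector :: "nat \<Rightarrow> (nat \<Rightarrow> real) \<Rightarrow> bool" where
  "prob_vector n p \<longleftrightarrow> (\<forall>i\<in>{1..n}. 0 \<le> p i) \<and> (\<Sum>i=1..n. p i) = 1"

lemma potential_shift:
  assumes "i \<in> {1..n}"
  shows "potential n \<phi> (shift n y i) = potential n \<phi> y + (jump n \<phi> (y i) - decay n \<phi> y)"
proof -
  have "potential n \<phi> (shift n y i) = 
      (\<Sum>j=1..n. \<phi> (y j - 1 / n) + (if j = i then jump n \<phi> (y j) else 0))"
    unfolding potential_def by (rule sum.cong) (auto simp: shift_def jump_def algebra_simps)
  also have "\<dots> = (\<Sum>j=1..n. \<phi> (y j - 1 / n)) + jump n \<phi> (y i)"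
    using assms by (simp add: sum.distrib)
  finally show ?thesis by (simp add: potential_def decay_def sum_subtractf)
qed

lemma mean_potential_shift:
  assumes "prob_vector n p"
  shows "(\<Sum>i=1..n. p i * potential n \<phi> (shift n y i)) =
    potential n \<phi> y + ((\<Sum>i=1..n. p i * jump n \<phi> (y i)) - decay n \<phi> y)"
proof -
  have "(\<Sum>i=1..n. p i * potential n \<phi> (shift n y i)) =
    (\<Sum>i=1..n. p i * (potential n \<phi> y - decay n \<phi> y) + p i * jump n \<phi> (y i))"
    by (rule sum.cong) (simp_all add: potential_shift algebra_simps)
  also have "\<dots> = (\<Sum>i=1..n. p i) * (potential n \<phi> y - decay n \<phi> y) + (\<Sum>i=1..n. p i * jump n \<phi> (y i))"
    by (simp add: sum.distrib sum_distrib_right)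
  finally show ?thesis using assms by (simp add: prob_vector_def)
qed

text \<open>\<open>decay\<close> is the same for every bin and factors out of the mean; what is left
  is linearised by \<open>B\<close> and closed with \<open>1 + x \<le> exp x\<close>.\<close>

lemma exp_mean_potential_shift:
  assumes "prob_vector n p"
    and "\<And>i. i \<in> {1..n} \<Longrightarrow> exp (\<theta> * jump n \<phi> (y i)) \<le> 1 + \<theta> * B i"
  shows "(\<Sum>i=1..n. p i * exp (\<theta> * (potential n \<phi> (shift n y i) - potential n \<phi> y)))
    \<le> exp (\<theta> * ((\<Sum>i=1..n. p i * B i) - decay n \<phi> y))"
proof -
  have "(\<Sum>i=1..n. p i * exp (\<theta> * (potential n \<phi> (shift n y i) - potential n \<phi> y))) =
     exp (- \<theta> * decay n \<phi> y) * (\<Sum>i=1..n. p i * exp (\<theta> * jump n \<phi> (y i)))"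
    unfolding sum_distrib_left
    by (rule sum.cong) (simp_all add: potential_shift algebra_simps flip: exp_add)
  also have "(\<Sum>i=1..n. p i * exp (\<theta> * jump n \<phi> (y i))) \<le> (\<Sum>i=1..n. p i * (1 + \<theta> * B i))"
    using assms by (intro sum_mono mult_left_mono) (auto simp: prob_vector_def)
  also have "\<dots> = 1 + \<theta> * (\<Sum>i=1..n. p i * B i)"
    using assms by (simp add: prob_vector_def algebra_simps sum.distrib sum_distrib_left)
  also have "\<dots> \<le> exp (\<theta> * (\<Sum>i=1..n. p i * B i))" by simp
  finally show ?thesis by (simp add: algebra_simps flip: exp_add)
qed

section \<open>The two-sided potential\<close>

text \<open>This is the tangent to sinh at -Q: left of -Q the slope cosh is at least cosh Q, between
  -Q and Q at most cosh Q, so sinh stays below the tangent.\<close>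

lemma sinh_tangent:
  fixes t Q :: real
  assumes "t \<le> Q" "0 \<le> Q"
  shows "sinh Q + sinh t \<le> cosh Q * (t + Q)"
proof -
  have der: "(sinh has_real_derivative cosh x) (at x)" for x :: real
    by (auto intro!: derivative_eq_intros)
  show ?thesis
  proof (cases "- Q \<le> t")
    case True
    show ?thesis
    proof (cases "t = - Q")
      case False
      with True have lt: "- Q < t" by simp
      obtain z where z: "- Q < z" "z < t" "sinh t - sinh (-Q) = (t - (-Q)) * cosh z"
        using MVT2[OF lt, of sinh cosh] der by metis
      have "cosh z \<le> cosh Q"
        using z assms cosh_real_nonneg_le_iff[of "\<bar>z\<bar>" Q] by (simp add: cosh_real_abs)
      then have "(t + Q) * cosh z \<le> (t + Q) * cosh Q" using lt by (intro mult_left_mono) auto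
      moreover have "sinh Q + sinh t = (t + Q) * cosh z" using z(3) by simp
      ultimately show ?thesis by (simp only: mult.commute)
    qed simp
  next
    case False
    then have lt: "t < - Q" by simp
    obtain z where z: "t < z" "z < - Q" "sinh (-Q) - sinh t = (-Q - t) * cosh z"
      using MVT2[OF lt, of sinh cosh] der by metis
    have "cosh Q \<le> cosh z"
      using z assms cosh_real_nonneg_le_iff[of Q "-z"] by auto
    then have "(-Q - t) * cosh Q \<le> (-Q - t) * cosh z" using lt by (intro mult_left_mono) auto
    then show ?thesis using z by (simp add: algebra_simps)
  qed
qed

text \<open>A substitute for Jensen's inequality, sinh being convex on the positive side: adding up
  the tangents at -Q makes the average of sinh at most sinh (-Q) as soon as the mean is at most
  -Q.\<close>

lemma sum_sinh_below:
  fixes x :: "'a \<Rightarrow> real"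
  assumes "finite S" "0 \<le> Q" "\<And>i. i \<in> S \<Longrightarrow> x i \<le> Q" "(\<Sum>i\<in>S. x i) \<le> - real (card S) * Q"
  shows "2 * real (card S) * sinh Q \<le> (\<Sum>i\<in>S. sinh Q - sinh (x i))"
proof -
  have "(\<Sum>i\<in>S. sinh Q + sinh (x i)) \<le> (\<Sum>i\<in>S. cosh Q * (x i + Q))"
    using assms by (intro sum_mono sinh_tangent) auto
  also have "\<dots> = cosh Q * ((\<Sum>i\<in>S. x i) + card S * Q)"
    by (simp add: sum_distrib_left[symmetric] sum.distrib)
  also have "\<dots> \<le> 0" using assms by (intro mult_nonneg_nonpos) auto
  finally show ?thesis by (simp add: sum.distrib sum_subtractf algebra_simps)
qed

text \<open>If the median value is nonnegative, the upper half has so large a sum that zero total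
  forces the mean of the other half down to at most minus the median, and the tangent bound applies
  there. The negative case is the mirror image on \<open>T\<close> without \<open>i0\<close>;
  dropping \<open>i0\<close> is what costs the 2.\<close>

lemma sum_abs_sinh_diff_median:
  fixes x :: "'a \<Rightarrow> real"
  assumes fin: "finite I" and T: "T \<subseteq> I" "card I \<le> 2 * card T" "2 * card T \<le> card I + 1"
    and zero: "(\<Sum>i\<in>I. x i) = 0" and i0: "i0 \<in> T"
    and top: "\<And>i. i \<in> T \<Longrightarrow> x i0 \<le> x i" and bot: "\<And>i. i \<in> I - T \<Longrightarrow> x i \<le> x i0"
  shows "(real (card I) - 2) * \<bar>sinh (x i0)\<bar> \<le> (\<Sum>i\<in>I. \<bar>sinh (x i) - sinh (x i0)\<bar>)"
proof -
  have finT: "finite T" using fin T finite_subset by blast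
  have split: "(\<Sum>i\<in>I. x i) = (\<Sum>i\<in>I-T. x i) + (\<Sum>i\<in>T. x i)"
    using sum.subset_diff[OF T(1) fin] by simp
  have cd: "card (I - T) = card I - card T" using T finT by (simp add: card_Diff_subset)
  have le: "card T \<le> card I" using T fin card_mono by blast
  show ?thesis
  proof (cases "0 \<le> x i0")
    case True
    have "real (card T) * x i0 \<le> (\<Sum>i\<in>T. x i)"
      using sum_mono[of T "\<lambda>_. x i0" x] top by simp
    moreover have "real (card (I - T)) * x i0 \<le> real (card T) * x i0"
      using cd le T True by (intro mult_right_mono) auto
    ultimately have "(\<Sum>i\<in>I-T. x i) \<le> - real (card (I - T)) * x i0" using split zero by simp
    from sum_sinh_below[OF _ True _ this] fin bot
    have "2 * real (card (I - T)) * sinh (x i0) \<le> (\<Sum>i\<in>I - T. sinh (x i0) - sinh (x i))" by simp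
    also have "\<dots> \<le> (\<Sum>i\<in>I - T. \<bar>sinh (x i) - sinh (x i0)\<bar>)" by (intro sum_mono) auto
    also have "\<dots> \<le> (\<Sum>i\<in>I. \<bar>sinh (x i) - sinh (x i0)\<bar>)" using fin by (intro sum_mono2) auto
    finally have *: "2 * real (card (I - T)) * sinh (x i0) \<le> (\<Sum>i\<in>I. \<bar>sinh (x i) - sinh (x i0)\<bar>)" .
    have "(real (card I) - 2) * sinh (x i0) \<le> 2 * real (card (I - T)) * sinh (x i0)"
      using True cd T le by (intro mult_right_mono) auto
    with * True show ?thesis by simp
  next
    case False
    define S where "S = T - {i0}"
    have cS: "card S = card T - 1" using i0 finT by (simp add: S_def)
    have c1: "1 \<le> card T" using i0 finT by (metis One_nat_def Suc_leI card_gt_0_iff empty_iff)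
    have sT: "(\<Sum>i\<in>T. x i) = x i0 + (\<Sum>i\<in>S. x i)"
      using i0 finT by (simp add: S_def sum.remove)
    have "(\<Sum>i\<in>I-T. x i) \<le> real (card (I - T)) * x i0"
      using sum_mono[of "I - T" x "\<lambda>_. x i0"] bot by simp
    moreover have "(real (card (I - T)) + 1) * x i0 \<le> real (card S) * x i0"
      using False cd cS c1 le T by (intro mult_right_mono_neg) auto
    ultimately have "(\<Sum>i\<in>S. - x i) \<le> - real (card S) * - x i0"
      using sT split zero by (simp add: sum_negf algebra_simps)
    from sum_sinh_below[OF _ _ _ this] finT top False
    have "2 * real (card S) * sinh (- x i0) \<le> (\<Sum>i\<in>S. sinh (- x i0) - sinh (- x i))"
      by (simp add: S_def)
    also have "\<dots> \<le> (\<Sum>i\<in>S. \<bar>sinh (x i) - sinh (x i0)\<bar>)" by (intro sum_mono) auto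
    also have "\<dots> \<le> (\<Sum>i\<in>I. \<bar>sinh (x i) - sinh (x i0)\<bar>)" 
      using fin T by (intro sum_mono2) (auto simp: S_def)
    finally have *: "2 * real (card S) * sinh (- x i0) \<le> (\<Sum>i\<in>I. \<bar>sinh (x i) - sinh (x i0)\<bar>)" .
    have "(real (card I) - 2) * sinh (- x i0) \<le> 2 * real (card S) * sinh (- x i0)"
      using False cS c1 T by (intro mult_right_mono) auto
    then have "(real (card I) - 2) * sinh (- x i0) \<le> (\<Sum>i\<in>I. \<bar>sinh (x i) - sinh (x i0)\<bar>)"
      using * by (rule order_trans)
    moreover have "\<bar>sinh (x i0)\<bar> = sinh (- x i0)" using False by simp
    ultimately show ?thesis by (simp only:)
  qed
qed

text \<open>\<open>i0\<close> plays the median. The two rates are those around the last quantile: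
  about (\<delta>_(k-1) + \<delta>_k)/n above it and (1 + \<delta>_k)/n below it, each at distance
  at least 49/100/n from the uniform rate 1/n.\<close>

definition top_half :: "nat \<Rightarrow> (nat \<Rightarrow> real) \<Rightarrow> (nat \<Rightarrow> real) \<Rightarrow> nat set \<Rightarrow> nat \<Rightarrow> bool" where
  "top_half n p y T i0 \<longleftrightarrow> T \<subseteq> {1..n} \<and> n \<le> 2 * card T \<and> 2 * card T \<le> n + 1 \<and> i0 \<in> T \<and>
     (\<forall>i\<in>T. y i0 \<le> y i \<and> p i \<le> 51 / 100 / n) \<and>
     (\<forall>i\<in>{1..n} - T. y i \<le> y i0 \<and> 3 / 2 / n \<le> p i)"

text \<open>Since the differences p i - 1/n sum to 0, sinh may be centred at its median value
  \<open>s\<close> for free. Then bins on either side of the median contribute negatively, and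
  \<open>sum_abs_sinh_diff_median\<close> turns the absolute deviations back into cosh - 1.\<close>

lemma sinh_drift:
  assumes pv: "prob_vector n p" and th: "top_half n p y T i0" and n: "100 \<le> n"
    and zero: "(\<Sum>i=1..n. y i) = 0" and \<beta>: "0 < \<beta>"
  shows "(\<Sum>i=1..n. (p i - 1 / n) * sinh (\<beta> * y i)) \<le> - (24 / 100 / n) * ((\<Sum>i=1..n. cosh (\<beta> * y i)) - n)"
proof -
  define s where "s = sinh (\<beta> * y i0)"
  define A where "A = (\<Sum>i=1..n. \<bar>sinh (\<beta> * y i) - s\<bar>)"
  have med: "(real n - 2) * \<bar>s\<bar> \<le> A"
    unfolding A_def s_def
    using sum_abs_sinh_diff_median[of "{1..n}" T "\<lambda>i. \<beta> * y i" i0] th zero \<beta>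
    by (auto simp: top_half_def simp flip: sum_distrib_left)
  have "(\<Sum>i=1..n. cosh (\<beta> * y i)) - n = (\<Sum>i=1..n. cosh (\<beta> * y i) - 1)"
    by (simp add: sum_subtractf)
  also have "\<dots> \<le> (\<Sum>i=1..n. \<bar>sinh (\<beta> * y i) - s\<bar> + \<bar>s\<bar>)"
  proof (intro sum_mono)
    fix i
    have "cosh (\<beta> * y i) - 1 \<le> \<bar>sinh (\<beta> * y i)\<bar>"
    proof -
      have "cosh \<bar>\<beta> * y i\<bar> - sinh \<bar>\<beta> * y i\<bar> \<le> 1" unfolding cosh_minus_sinh by simp
      then show ?thesis by (simp add: sinh_real_abs)
    qed
    then show "cosh (\<beta> * y i) - 1 \<le> \<bar>sinh (\<beta> * y i) - s\<bar> + \<bar>s\<bar>" by linarith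
  qed
  also have "\<dots> = A + n * \<bar>s\<bar>" by (simp add: sum.distrib A_def)
  finally have c: "(\<Sum>i=1..n. cosh (\<beta> * y i)) - n \<le> A + n * \<bar>s\<bar>" .
  \<comment> \<open>n \<ge> 100 replaces n - 2 by 98/100 n; then 24 (1 + 100/98) \<le> 49 fixes the
    factor 24.\<close>
  have "98 * (real n * \<bar>s\<bar>) \<le> 100 * ((real n - 2) * \<bar>s\<bar>)"
    using n mult_right_mono[of 200 "real n * 2" "\<bar>s\<bar>"] by (simp add: algebra_simps)
  moreover define z where "z = real n * \<bar>s\<bar>"
  ultimately have "98 * z \<le> 100 * A" using med by linarith
  moreover have "0 \<le> A" unfolding A_def by (intro sum_nonneg) auto
  ultimately have c: "24 * ((\<Sum>i=1..n. cosh (\<beta> * y i)) - n) \<le> 49 * A" using c unfolding z_def[symmetric] by (simp add: field_simps)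
  have "(\<Sum>i=1..n. (p i - 1 / n) * sinh (\<beta> * y i)) =
     (\<Sum>i=1..n. (p i - 1 / n) * (sinh (\<beta> * y i) - s)) + (\<Sum>i=1..n. p i - 1 / n) * s"
    unfolding sum_distrib_right sum.distrib[symmetric] by (rule sum.cong) (auto simp: algebra_simps)
  also have "(\<Sum>i=1..n. p i - 1 / n) = 0" using pv n by (simp add: prob_vector_def sum_subtractf)
  also have "(\<Sum>i=1..n. (p i - 1 / n) * (sinh (\<beta> * y i) - s)) \<le> 
     (\<Sum>i=1..n. - (49 / 100 / n) * \<bar>sinh (\<beta> * y i) - s\<bar>)"
  proof (intro sum_mono)
    fix i assume i: "i \<in> {1..n}"
    show "(p i - 1 / n) * (sinh (\<beta> * y i) - s) \<le> - (49 / 100 / n) * \<bar>sinh (\<beta> * y i) - s\<bar>"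
    proof (cases "i \<in> T")
      case True
      then have "s \<le> sinh (\<beta> * y i)" "p i - 1 / n \<le> - (49 / 100 / n)"
        using th \<beta> by (auto simp: s_def top_half_def field_simps)
      then have "(p i - 1 / n) * (sinh (\<beta> * y i) - s) \<le> - (49 / 100 / n) * (sinh (\<beta> * y i) - s)"
        by (intro mult_right_mono) auto
      with \<open>s \<le> sinh (\<beta> * y i)\<close> show ?thesis by simp
    next
      case False
      then have "sinh (\<beta> * y i) \<le> s" "p i \<ge> 3 / 2 / n"
        using th \<beta> i n by (auto simp: s_def top_half_def)
      then have "sinh (\<beta> * y i) \<le> s" "p i - 1 / n \<ge> 49 / 100 / n"
        using n by (auto simp: field_simps)
      then have "(p i - 1 / n) * (sinh (\<beta> * y i) - s) \<le> (49 / 100 / n) * (sinh (\<beta> * y i) - s)"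
        by (intro mult_right_mono_neg) auto
      moreover have "\<bar>sinh (\<beta> * y i) - s\<bar> = - (sinh (\<beta> * y i) - s)" using \<open>sinh (\<beta> * y i) \<le> s\<close> by simp
      ultimately show ?thesis by (simp only: mult_minus_left mult_minus_right minus_minus)
    qed
  qed
  also have "\<dots> = - (49 / 100 / n) * A" by (simp add: A_def sum_distrib_left)
  also have "\<dots> \<le> - (24 / 100 / n) * ((\<Sum>i=1..n. cosh (\<beta> * y i)) - n)"
  proof -
    define C where "C = (\<Sum>i=1..n. cosh (\<beta> * y i)) - n"
    have "1 / (100 * real n) * (24 * C) \<le> 1 / (100 * real n) * (49 * A)"
      using c unfolding C_def by (intro mult_left_mono) auto
    then show ?thesis unfolding C_def[symmetric] by simp
  qed
  finally show ?thesis by simp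
qed

definition two_sided :: "real \<Rightarrow> real \<Rightarrow> real" where
  "two_sided \<beta> x = 2 * cosh (\<beta> * x)"

lemma two_sided_eq: "two_sided \<beta> x = exp (\<beta> * x) + exp (- (\<beta> * x))"
  by (simp add: two_sided_def cosh_def)

text \<open>Holding for all negative arguments, the bound serves drops as well as rises. For -1 < x
  < 0 the product of 1 + x + x^2 with the Taylor bound of exp (-x) is at least 1.\<close>

lemma exp_le_quadratic:
  fixes x :: real assumes "x \<le> 1" shows "exp x \<le> 1 + x + x\<^sup>2"
proof (cases "0 \<le> x")
  case True then show ?thesis using assms exp_bound by blast
next
  case False
  show ?thesis
  proof (cases "x \<le> -1")
    case True
    have "exp x \<le> 1" using True by simp
    moreover have "0 \<le> x * (1 + x)" using True by (intro mult_nonpos_nonpos) auto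
    moreover have "x * (1 + x) = x + x\<^sup>2" by (simp add: power2_eq_square algebra_simps)
    ultimately show ?thesis by linarith
  next
    case F2: False
    have "exp (-x) \<ge> 1 + (-x) + x\<^sup>2 / 2"
    proof -
      obtain t where t: "\<bar>t\<bar> \<le> \<bar>-x\<bar>" "exp (-x) = (\<Sum>m<3. (-x) ^ m / fact m) + exp t / fact 3 * (-x) ^ 3"
        using Maclaurin_exp_le[of "-x" 3] by blast
      moreover have "0 \<le> exp t / fact 3 * (-x) ^ 3" using False by (intro mult_nonneg_nonneg) auto
      ultimately show ?thesis by (simp add: numeral_3_eq_3 lessThan_Suc fact_numeral power2_eq_square)
    qed
    then have "(1 + x + x\<^sup>2) * exp (-x) \<ge> (1 + x + x\<^sup>2) * (1 + (-x) + x\<^sup>2 / 2)"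
      using F2 False by (intro mult_left_mono) (auto intro!: add_nonneg_nonneg)
    moreover have "(1 + x + x\<^sup>2) * (1 + (-x) + x\<^sup>2 / 2) = 1 + x\<^sup>2 / 2 * (1 - x + x\<^sup>2)"
      by (simp add: field_simps power2_eq_square)
    moreover have "0 \<le> x\<^sup>2 / 2 * (1 - x + x\<^sup>2)" using False by (intro mult_nonneg_nonneg) (auto intro!: add_nonneg_nonneg)
    ultimately have "1 \<le> (1 + x + x\<^sup>2) * exp (-x)" by linarith
    then show ?thesis by (simp add: exp_minus field_simps)
  qed
qed

text \<open>Expansion to second order in \<beta>: the first-order terms of the two exponentials have
  opposite signs and combine to sinh, the second-order ones add up to at most p \<beta>^2 +
  (\<beta>/n)^2 \<le> 3 \<beta>^2/n.\<close>

lemma two_sided_step: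
  assumes \<beta>: "0 < \<beta>" "\<beta> \<le> 1 / 50" and n: "1 \<le> n" and p: "0 \<le> p" "p \<le> 2 / real n"
  shows "p * jump n (two_sided \<beta>) y - (two_sided \<beta> y - two_sided \<beta> (y - 1 / n))
     \<le> 2 * \<beta> * ((p - 1 / n) * sinh (\<beta> * y)) + 3 * \<beta>\<^sup>2 / n * two_sided \<beta> y"
proof -
  define r where "r = \<beta> / n"
  have r: "0 < r" "r \<le> \<beta>" using \<beta> n by (auto simp: r_def field_simps)
  have pb: "p * \<beta>\<^sup>2 + r\<^sup>2 \<le> 3 * \<beta>\<^sup>2 / n"
  proof -
    have "p * \<beta>\<^sup>2 \<le> 2 / n * \<beta>\<^sup>2" using p by (intro mult_right_mono) auto
    moreover have "r\<^sup>2 \<le> \<beta>\<^sup>2 / n" using n \<beta> by (simp add: r_def power2_eq_square divide_simps)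
    ultimately show ?thesis by (simp add: field_simps)
  qed
  have em: "exp (- r) \<le> 1 - r + r\<^sup>2" using exp_le_quadratic[of "-r"] r by simp
  have ep: "exp r \<le> 1 + r + r\<^sup>2" using exp_le_quadratic[of r] r \<beta> by simp
  have eb: "exp \<beta> - 1 \<le> \<beta> + \<beta>\<^sup>2" using exp_le_quadratic[of \<beta>] \<beta> by simp
  have ebm: "1 - exp (- \<beta>) \<ge> \<beta> - \<beta>\<^sup>2" using exp_le_quadratic[of "-\<beta>"] \<beta> by simp
  have up: "p * (exp (-r) * (exp \<beta> - 1)) + exp (- r) - 1 \<le> (p - 1 / n) * \<beta> + 3 * \<beta>\<^sup>2 / n"
  proof -
    have "exp (-r) * (exp \<beta> - 1) \<le> 1 * (\<beta> + \<beta>\<^sup>2)" using r \<beta> eb by (intro mult_mono) auto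
    then have "p * (exp (-r) * (exp \<beta> - 1)) \<le> p * (\<beta> + \<beta>\<^sup>2)" using p by (intro mult_left_mono) auto
    with em pb show ?thesis by (simp add: r_def algebra_simps)
  qed
  have dn: "p * (exp r * (exp (-\<beta>) - 1)) + exp r - 1 \<le> - (p - 1 / n) * \<beta> + 3 * \<beta>\<^sup>2 / n"
  proof -
    have "exp r * (exp (-\<beta>) - 1) \<le> 1 * (exp (-\<beta>) - 1)" using r \<beta> by (intro mult_right_mono_neg) auto
    also have "\<dots> \<le> - (\<beta> - \<beta>\<^sup>2)" using ebm by simp
    finally have "p * (exp r * (exp (-\<beta>) - 1)) \<le> p * - (\<beta> - \<beta>\<^sup>2)" using p by (intro mult_left_mono) auto
    with ep pb show ?thesis by (simp add: r_def algebra_simps)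
  qed
  have e1: "exp (\<beta> * (y + 1 - 1 / n)) = exp (\<beta> * y) * (exp (-r) * exp \<beta>)"
    "exp (\<beta> * (y - 1 / n)) = exp (\<beta> * y) * exp (-r)"
    "exp (- (\<beta> * (y + 1 - 1 / n))) = exp (- (\<beta> * y)) * (exp r * exp (-\<beta>))"
    "exp (- (\<beta> * (y - 1 / n))) = exp (- (\<beta> * y)) * exp r"
    by (simp_all add: r_def algebra_simps flip: exp_add)
  have "p * jump n (two_sided \<beta>) y - (two_sided \<beta> y - two_sided \<beta> (y - 1 / n)) =
     exp (\<beta> * y) * (p * (exp (-r) * (exp \<beta> - 1)) + exp (- r) - 1) + 
     exp (- (\<beta> * y)) * (p * (exp r * (exp (-\<beta>) - 1)) + exp r - 1)"
    unfolding jump_def two_sided_eq e1 by (simp add: algebra_simps)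
  also have "\<dots> \<le> exp (\<beta> * y) * ((p - 1 / n) * \<beta> + 3 * \<beta>\<^sup>2 / n) + 
     exp (- (\<beta> * y)) * (- (p - 1 / n) * \<beta> + 3 * \<beta>\<^sup>2 / n)"
    by (intro add_mono mult_left_mono up dn) auto
  also have "\<dots> = 2 * \<beta> * ((p - 1 / n) * sinh (\<beta> * y)) + 3 * \<beta>\<^sup>2 / n * two_sided \<beta> y"
  proof -
    have "2 * sinh (\<beta> * y) = exp (\<beta> * y) - exp (- (\<beta> * y))" by (simp add: sinh_def)
    then have "2 * \<beta> * ((p - 1 / n) * sinh (\<beta> * y)) = \<beta> * (p - 1 / n) * (exp (\<beta> * y) - exp (- (\<beta> * y)))"
      by (metis mult.assoc mult.left_commute)
    then show ?thesis unfolding two_sided_eq by (simp only:) (simp add: algebra_simps add_divide_distrib)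
  qed
  finally show ?thesis .
qed

text \<open>\<open>sinh_drift\<close> yields 48/100 n minus 24/100 of the potential, and \<beta>
  \<le> 1/50 bounds the second-order error 3 \<beta> by 6/100, which leaves 18/100.\<close>

lemma two_sided_mean_drift:
  assumes pv: "prob_vector n p" and th: "top_half n p y T i0" and n: "100 \<le> n"
    and p2: "\<And>i. i \<in> {1..n} \<Longrightarrow> p i \<le> 2 / n"
    and zero: "(\<Sum>i=1..n. y i) = 0" and \<beta>: "0 < \<beta>" "\<beta> \<le> 1 / 50"
  shows "(\<Sum>i=1..n. p i * jump n (two_sided \<beta>) (y i)) - decay n (two_sided \<beta>) y
    \<le> \<beta> / n * (48 / 100 * n - 18 / 100 * potential n (two_sided \<beta>) y)"
proof -
  have "(\<Sum>i=1..n. p i * jump n (two_sided \<beta>) (y i)) - decay n (two_sided \<beta>) y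
     \<le> (\<Sum>i=1..n. 2 * \<beta> * ((p i - 1 / n) * sinh (\<beta> * y i)) + 3 * \<beta>\<^sup>2 / n * two_sided \<beta> (y i))"
    unfolding decay_def sum_subtractf[symmetric]
    using assms by (intro sum_mono two_sided_step) (auto simp: prob_vector_def)
  also have "\<dots> = 2 * \<beta> * (\<Sum>i=1..n. (p i - 1 / n) * sinh (\<beta> * y i)) + 3 * \<beta>\<^sup>2 / n * potential n (two_sided \<beta>) y"
    by (simp add: sum.distrib potential_def sum_distrib_left)
  also have "\<dots> \<le> 2 * \<beta> * (- (24 / 100 / n) * ((\<Sum>i=1..n. cosh (\<beta> * y i)) - n)) + 3 * \<beta>\<^sup>2 / n * potential n (two_sided \<beta>) y"
    using sinh_drift[OF pv th n zero \<beta>(1)] \<beta> by (intro add_right_mono mult_left_mono) auto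
  also have "(\<Sum>i=1..n. cosh (\<beta> * y i)) = potential n (two_sided \<beta>) y / 2"
    by (simp add: potential_def two_sided_def sum_distrib_left[symmetric])
  also have "3 * \<beta>\<^sup>2 / n * potential n (two_sided \<beta>) y \<le> \<beta> / n * (6 / 100 * potential n (two_sided \<beta>) y)"
  proof -
    have "0 \<le> potential n (two_sided \<beta>) y" by (simp add: potential_def two_sided_def sum_nonneg)
    then have "(3 * \<beta>) * potential n (two_sided \<beta>) y \<le> 6 / 100 * potential n (two_sided \<beta>) y" 
      using \<beta> by (intro mult_right_mono) auto
    then have "\<beta> / n * ((3 * \<beta>) * potential n (two_sided \<beta>) y) \<le> \<beta> / n * (6 / 100 * potential n (two_sided \<beta>) y)"
      using \<beta> by (intro mult_left_mono) auto
    then show ?thesis by (simp add: power2_eq_square mult_ac)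
  qed
  finally show ?thesis using n by (simp add: field_simps)
qed

lemma abs_jump_two_sided:
  assumes \<beta>: "0 < \<beta>" "\<beta> \<le> 1 / 50" and n: "1 \<le> n"
  shows "\<bar>jump n (two_sided \<beta>) y\<bar> \<le> 51 / 50 * \<beta> * two_sided \<beta> y"
proof -
  define r where "r = \<beta> / n"
  have r: "0 < r" "r \<le> \<beta>" using \<beta> n by (auto simp: r_def field_simps)
  have e1: "exp (\<beta> * (y + 1 - 1 / n)) = exp (\<beta> * y) * (exp (-r) * exp \<beta>)"
    "exp (\<beta> * (y - 1 / n)) = exp (\<beta> * y) * exp (-r)"
    "exp (- (\<beta> * (y + 1 - 1 / n))) = exp (- (\<beta> * y)) * (exp r * exp (-\<beta>))"
    "exp (- (\<beta> * (y - 1 / n))) = exp (- (\<beta> * y)) * exp r"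
    by (simp_all add: r_def algebra_simps flip: exp_add)
  have eb: "exp \<beta> - 1 \<le> 51 / 50 * \<beta>"
  proof -
    have "\<beta>\<^sup>2 \<le> \<beta> / 50" using \<beta> by (simp add: power2_eq_square)
    then show ?thesis using exp_le_quadratic[of \<beta>] \<beta> by simp
  qed
  define U where "U = exp (\<beta> * y) * (exp (-r) * (exp \<beta> - 1))"
  define D where "D = exp (- (\<beta> * y)) * (exp r * (1 - exp (-\<beta>)))"
  have U: "0 \<le> U" "U \<le> exp (\<beta> * y) * (51 / 50 * \<beta>)"
  proof -
    have "exp (-r) * (exp \<beta> - 1) \<le> 1 * (51 / 50 * \<beta>)" using r \<beta> eb by (intro mult_mono) auto
    then show "U \<le> exp (\<beta> * y) * (51 / 50 * \<beta>)" unfolding U_def by (intro mult_left_mono) auto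
  qed (use \<beta> in \<open>simp add: U_def\<close>)
  have D: "0 \<le> D" "D \<le> exp (-(\<beta> * y)) * (51 / 50 * \<beta>)"
  proof -
    have "exp r * (1 - exp (-\<beta>)) \<le> exp \<beta> * (1 - exp (-\<beta>))" using r \<beta> by (intro mult_right_mono) auto
    also have "\<dots> = exp \<beta> - 1" by (simp add: algebra_simps flip: exp_add)
    finally have "exp r * (1 - exp (-\<beta>)) \<le> 51 / 50 * \<beta>" using eb by simp
    then show "D \<le> exp (-(\<beta> * y)) * (51 / 50 * \<beta>)" unfolding D_def by (intro mult_left_mono) auto
  qed (use \<beta> in \<open>simp add: D_def\<close>)
  have "jump n (two_sided \<beta>) y = U - D"
    unfolding jump_def two_sided_eq e1 U_def D_def by (simp add: algebra_simps)
  then have "\<bar>jump n (two_sided \<beta>) y\<bar> \<le> U + D" using U D by linarith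
  also have "\<dots> \<le> 51 / 50 * \<beta> * two_sided \<beta> y" using U D unfolding two_sided_eq by (simp add: algebra_simps)
  finally show ?thesis .
qed

text \<open>Each scaled jump is at most 3/1000 in absolute value, so the quadratic term costs only
  that fraction of the linear one. The rounded coefficients 1/2 and 15/100 are the form of drift
  shared by all layers.\<close>

lemma two_sided_exp_drift:
  assumes pv: "prob_vector n p" and th: "top_half n p y T i0" and n: "100 \<le> n"
    and p2: "\<And>i. i \<in> {1..n} \<Longrightarrow> p i \<le> 2 / n"
    and zero: "(\<Sum>i=1..n. y i) = 0" and \<beta>: "0 < \<beta>" "\<beta> \<le> 1 / 50"
    and \<theta>: "0 \<le> \<theta>" "\<And>i. i \<in> {1..n} \<Longrightarrow> \<theta> * two_sided \<beta> (y i) \<le> 1 / 10"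
  shows "(\<Sum>i=1..n. p i * exp (\<theta> * (potential n (two_sided \<beta>) (shift n y i) - potential n (two_sided \<beta>) y)))
    \<le> exp (\<theta> * (\<beta> / n * (n / 2 - 15 / 100 * potential n (two_sided \<beta>) y)))"
proof -
  let ?J = "\<lambda>i. jump n (two_sided \<beta>) (y i)"
  let ?\<Phi> = "potential n (two_sided \<beta>) y"
  have J: "\<theta> * \<bar>?J i\<bar> \<le> 3 / 1000" if "i \<in> {1..n}" for i
  proof -
    have "\<theta> * \<bar>?J i\<bar> \<le> \<theta> * (51 / 50 * \<beta> * two_sided \<beta> (y i))"
      using abs_jump_two_sided[OF \<beta>, of n "y i"] n \<theta> by (intro mult_left_mono) auto
    also have "\<dots> = (51 / 50 * \<beta>) * (\<theta> * two_sided \<beta> (y i))" by simp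
    also have "\<dots> \<le> (51 / 50 * (1 / 50)) * (1 / 10)" 
      using \<beta> \<theta> that by (intro mult_mono) (auto simp: two_sided_def)
    finally show ?thesis by simp
  qed
  have "(\<Sum>i=1..n. p i * exp (\<theta> * (potential n (two_sided \<beta>) (shift n y i) - potential n (two_sided \<beta>) y)))
    \<le> exp (\<theta> * ((\<Sum>i=1..n. p i * (?J i + 3 / 1000 * \<bar>?J i\<bar>)) - decay n (two_sided \<beta>) y))"
  proof (rule exp_mean_potential_shift[OF pv])
    fix i assume i: "i \<in> {1..n}"
    have "\<theta> * ?J i \<le> \<theta> * \<bar>?J i\<bar>" using \<theta> by (intro mult_left_mono) auto
    then have "exp (\<theta> * ?J i) \<le> 1 + \<theta> * ?J i + (\<theta> * ?J i)\<^sup>2"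
      using J[OF i] by (intro exp_le_quadratic) linarith
    also have "(\<theta> * ?J i)\<^sup>2 = (\<theta> * \<bar>?J i\<bar>) * (\<theta> * \<bar>?J i\<bar>)" by (simp add: power2_eq_square mult_ac)
    also have "\<dots> \<le> 3 / 1000 * (\<theta> * \<bar>?J i\<bar>)" using J[OF i] \<theta> by (intro mult_right_mono) auto
    finally show "exp (\<theta> * ?J i) \<le> 1 + \<theta> * (?J i + 3 / 1000 * \<bar>?J i\<bar>)" by (simp add: algebra_simps)
  qed
  also have "\<dots> \<le> exp (\<theta> * (\<beta> / n * (n / 2 - 15 / 100 * ?\<Phi>)))"
  proof -
    have "(\<Sum>i=1..n. p i * \<bar>?J i\<bar>) \<le> (\<Sum>i=1..n. 2 / n * (51 / 50 * \<beta> * two_sided \<beta> (y i)))"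
      using abs_jump_two_sided[OF \<beta>] n p2 pv by (intro sum_mono mult_mono) (auto simp: prob_vector_def)
    also have "\<dots> = \<beta> / n * (102 / 50 * ?\<Phi>)"
      unfolding potential_def sum_distrib_left by (rule sum.cong) auto
    finally have "3 / 1000 * (\<Sum>i=1..n. p i * \<bar>?J i\<bar>) \<le> \<beta> / n * (306 / 50000 * ?\<Phi>)" by simp
    moreover have "(\<Sum>i=1..n. p i * (?J i + 3 / 1000 * \<bar>?J i\<bar>)) = 
      (\<Sum>i=1..n. p i * ?J i) + 3 / 1000 * (\<Sum>i=1..n. p i * \<bar>?J i\<bar>)"
      by (simp add: algebra_simps sum.distrib sum_distrib_left)
    ultimately have "(\<Sum>i=1..n. p i * (?J i + 3 / 1000 * \<bar>?J i\<bar>)) - decay n (two_sided \<beta>) y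
      \<le> \<beta> / n * (48 / 100 * n - 18 / 100 * ?\<Phi>) + \<beta> / n * (306 / 50000 * ?\<Phi>)"
      using two_sided_mean_drift[OF pv th n p2 zero \<beta>] by linarith
    also have "\<dots> = \<beta> / n * (48 / 100 * n - (18 / 100 - 306 / 50000) * ?\<Phi>)" by (simp add: algebra_simps)
    also have "\<dots> \<le> \<beta> / n * (n / 2 - 15 / 100 * ?\<Phi>)"
    proof (intro mult_left_mono diff_mono mult_right_mono)
      show "0 \<le> ?\<Phi>" by (simp add: potential_def two_sided_def sum_nonneg)
    qed (use \<beta> in auto)
    finally have "\<theta> * ((\<Sum>i=1..n. p i * (?J i + 3 / 1000 * \<bar>?J i\<bar>)) - decay n (two_sided \<beta>) y)
      \<le> \<theta> * (\<beta> / n * (n / 2 - 15 / 100 * ?\<Phi>))"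
      using \<theta>(1) by (rule mult_left_mono)
    then show ?thesis by simp
  qed
  finally show ?thesis .
qed

section \<open>The one-sided potentials\<close>

text \<open>The slow rate \<open>b\<close> above \<open>H\<close> keeps each layer comparable to the
  one before it: far up, both grow at the same rate.\<close>

definition ladder :: "real \<Rightarrow> real \<Rightarrow> real \<Rightarrow> real \<Rightarrow> real \<Rightarrow> real" where
  "ladder b \<rho> h H x = exp (\<rho> * max 0 (min x H - h) + b * max 0 (x - H))"

lemma ladder_pos: "0 < ladder b \<rho> h H x"
  by (simp add: ladder_def)

lemma ladder_ge_1: "0 \<le> b \<Longrightarrow> 0 \<le> \<rho> \<Longrightarrow> 1 \<le> ladder b \<rho> h H x"
  by (simp add: ladder_def)

lemma ladder_eq_1: "h \<le> H \<Longrightarrow> x \<le> h \<Longrightarrow> ladder b \<rho> h H x = 1"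
  by (simp add: ladder_def)

lemma ladder_mono:
  assumes "0 \<le> b" "0 \<le> \<rho>" "x \<le> x'" shows "ladder b \<rho> h H x \<le> ladder b \<rho> h H x'"
  unfolding ladder_def exp_le_cancel_iff using assms
  by (intro add_mono mult_left_mono) auto

lemma ladder_growth:
  assumes "0 \<le> b" "b \<le> \<rho>" "0 \<le> d" "h \<le> H"
  shows "ladder b \<rho> h H (x + d) \<le> exp (\<rho> * d) * ladder b \<rho> h H x"
proof -
  define u where "u = max 0 (min (x + d) H - h) - max 0 (min x H - h)"
  define v where "v = max 0 (x + d - H) - max 0 (x - H)"
  have "0 \<le> u" "0 \<le> v" "u + v \<le> d" using assms by (auto simp: u_def v_def min_def max_def)
  then have "\<rho> * u + b * v \<le> \<rho> * u + \<rho> * v" using assms by (intro add_left_mono mult_right_mono) auto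
  also have "\<dots> \<le> \<rho> * d" using \<open>u + v \<le> d\<close> assms by (simp add: mult_left_mono flip: distrib_left)
  finally show ?thesis unfolding ladder_def
    by (simp add: u_def v_def algebra_simps flip: exp_add)
qed

text \<open>Above \<open>h\<close> the exponent has slope at least \<open>b\<close>. If the drop
  reaches \<open>h\<close>, the lowered value is 1 and the whole excess over 1 is lost; this is why
  the excess appears on the left.\<close>

lemma ladder_decay:
  assumes "0 \<le> b" "b \<le> \<rho>" "0 \<le> d" "b * d \<le> 1" "h \<le> H"
  shows "b * d / 2 * (ladder b \<rho> h H x - 1) \<le> ladder b \<rho> h H x - ladder b \<rho> h H (x - d)"
proof -
  have ge1: "1 \<le> ladder b \<rho> h H x" using assms by (intro ladder_ge_1) auto
  show ?thesis
  proof (cases "x - d \<le> h")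
    case True
    have "b * d / 2 * (ladder b \<rho> h H x - 1) \<le> 1 * (ladder b \<rho> h H x - 1)"
      using ge1 assms by (intro mult_right_mono) auto
    then show ?thesis using ladder_eq_1[OF assms(5) True] by simp
  next
    case False
    define u where "u = max 0 (min x H - h) - max 0 (min (x - d) H - h)"
    define v where "v = max 0 (x - H) - max 0 (x - d - H)"
    have uv: "0 \<le> u" "0 \<le> v" "u + v = d" using assms False by (auto simp: u_def v_def min_def max_def)
    have "b * d = b * u + b * v" using uv by (simp flip: distrib_left)
    also have "\<dots> \<le> \<rho> * u + b * v" using assms uv by (intro add_right_mono mult_right_mono) auto
    finally have "ladder b \<rho> h H (x - d) \<le> exp (- (b * d)) * ladder b \<rho> h H x"
      unfolding ladder_def by (simp add: u_def v_def algebra_simps flip: exp_add)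
    also have "\<dots> \<le> (1 - b * d / 2) * ladder b \<rho> h H x"
    proof (intro mult_right_mono)
      show "exp (- (b * d)) \<le> 1 - b * d / 2"
      proof -
        \<comment> \<open>The chord of exp over [-1, 0], together with exp (-1) \<le> 1/2, gives the
          slope 1/2.\<close>
        have "convex_on UNIV (\<lambda>x::real. exp x)" by (rule exp_convex)
        then have "exp ((1 - b * d) * 0 + b * d * (-1)) \<le> (1 - b * d) * exp 0 + b * d * exp (-1 :: real)"
          using assms convex_onD[of UNIV exp "b * d" 0 "-1"] by simp
        moreover have "exp (-1 :: real) \<le> 1 / 2" 
          using exp_ge_add_one_self[of "1::real"] by (simp add: exp_minus field_simps)
        then have "b * d * exp (-1) \<le> b * d * (1 / 2)" using assms by (intro mult_left_mono) auto
        ultimately show ?thesis by simp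
      qed
    qed (simp add: ladder_def)
    finally have "ladder b \<rho> h H (x - d) \<le> (1 - b * d / 2) * ladder b \<rho> h H x" .
    moreover have "b * d / 2 * (ladder b \<rho> h H x - 1) \<le> b * d / 2 * ladder b \<rho> h H x"
      using assms by (intro mult_left_mono) auto
    ultimately show ?thesis by (simp add: algebra_simps)
  qed
qed

lemma potential_ladder_ge: 
  assumes "0 \<le> b" "0 \<le> \<rho>" shows "real n \<le> potential n (ladder b \<rho> h H) y"
proof -
  have "(\<Sum>j=1..n. (1::real)) \<le> potential n (ladder b \<rho> h H) y"
    unfolding potential_def by (intro sum_mono ladder_ge_1 assms)
  then show ?thesis by simp
qed

text \<open>The third part is the origin of the level h - 1 further on: a bin at or below it cannot
  climb past \<open>h\<close>, so receiving a ball leaves its contribution at 1.\<close>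

lemma jump_ladder:
  assumes "0 \<le> b" "b \<le> \<rho>" "h \<le> H" "1 \<le> n"
  shows "0 \<le> jump n (ladder b \<rho> h H) x" "jump n (ladder b \<rho> h H) x \<le> exp \<rho> * ladder b \<rho> h H x"
    "x \<le> h - 1 \<Longrightarrow> jump n (ladder b \<rho> h H) x = 0"
proof -
  show "0 \<le> jump n (ladder b \<rho> h H) x"
    unfolding jump_def using assms by (simp add: ladder_mono)
  have "ladder b \<rho> h H (x + 1 - 1 / n) \<le> ladder b \<rho> h H (x + 1)" using assms by (intro ladder_mono) auto
  also have "\<dots> \<le> exp (\<rho> * 1) * ladder b \<rho> h H x" using assms by (intro ladder_growth) auto
  finally show "jump n (ladder b \<rho> h H) x \<le> exp \<rho> * ladder b \<rho> h H x"
    using ladder_pos[of b \<rho> h H "x - 1 / n"] by (simp add: jump_def)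
  show "jump n (ladder b \<rho> h H) x = 0" if "x \<le> h - 1"
  proof -
    have "0 \<le> 1 / real n" by simp
    with that have "x + 1 - 1 / n \<le> h" "x - 1 / n \<le> h" by linarith+
    then show ?thesis using assms(3) by (simp add: jump_def ladder_eq_1)
  qed
qed

lemma decay_ladder:
  assumes "0 \<le> b" "b \<le> \<rho>" "b \<le> 1" "h \<le> H" "1 \<le> n"
  shows "b / n / 2 * (potential n (ladder b \<rho> h H) y - n) \<le> decay n (ladder b \<rho> h H) y"
    "0 \<le> decay n (ladder b \<rho> h H) y"
proof -
  have "(\<Sum>j=1..n. b * (1 / n) / 2 * (ladder b \<rho> h H (y j) - 1)) \<le> decay n (ladder b \<rho> h H) y"
    unfolding decay_def using assms by (intro sum_mono ladder_decay) (auto simp: field_simps)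
  then show *: "b / n / 2 * (potential n (ladder b \<rho> h H) y - n) \<le> decay n (ladder b \<rho> h H) y"
    unfolding sum_distrib_left[symmetric] by (simp add: potential_def sum_subtractf)
  have "0 \<le> b / n / 2 * (potential n (ladder b \<rho> h H) y - n)"
    using assms potential_ladder_ge[of b \<rho> n h H y] by (intro mult_nonneg_nonneg) auto
  with * show "0 \<le> decay n (ladder b \<rho> h H) y" by linarith
qed

lemma sum_jump_ladder_le:
  assumes "0 \<le> b" "b \<le> \<rho>" "h \<le> H" "1 \<le> n" "0 \<le> r" and pv: "prob_vector n p"
    and p: "\<And>i. i \<in> {1..n} \<Longrightarrow> h - 1 < y i \<Longrightarrow> p i \<le> r"
  shows "(\<Sum>i=1..n. p i * jump n (ladder b \<rho> h H) (y i)) \<le> r * exp \<rho> * potential n (ladder b \<rho> h H) y"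
  unfolding potential_def sum_distrib_left
proof (intro sum_mono)
  fix i assume i: "i \<in> {1..n}"
  show "p i * jump n (ladder b \<rho> h H) (y i) \<le> r * exp \<rho> * ladder b \<rho> h H (y i)"
  proof (cases "h - 1 < y i")
    case True
    have "p i * jump n (ladder b \<rho> h H) (y i) \<le> r * (exp \<rho> * ladder b \<rho> h H (y i))"
      using assms p[OF i True] jump_ladder[OF assms(1-4)] i by (intro mult_mono) (auto simp: prob_vector_def)
    then show ?thesis by (simp add: mult_ac)
  next
    case False
    then show ?thesis using jump_ladder(3)[OF assms(1-4)] assms ladder_pos[of b \<rho> h H "y i"] by simp
  qed
qed

text \<open>Scaled jumps lie between 0 and 1, so exp t \<le> 1 + t + t^2 \<le> 1 + 2 t; hence the
  doubled jump term.\<close>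

lemma ladder_exp_mean:
  assumes "0 \<le> b" "b \<le> \<rho>" "h \<le> H" "1 \<le> n" and pv: "prob_vector n p"
    and \<theta>: "0 \<le> \<theta>" "\<And>i. i \<in> {1..n} \<Longrightarrow> \<theta> * (exp \<rho> * ladder b \<rho> h H (y i)) \<le> 1"
  shows "(\<Sum>i=1..n. p i * exp (\<theta> * (potential n (ladder b \<rho> h H) (shift n y i) - potential n (ladder b \<rho> h H) y)))
    \<le> exp (\<theta> * (2 * (\<Sum>i=1..n. p i * jump n (ladder b \<rho> h H) (y i)) - decay n (ladder b \<rho> h H) y))"
proof -
  let ?J = "\<lambda>i. jump n (ladder b \<rho> h H) (y i)"
  have "(\<Sum>i=1..n. p i * exp (\<theta> * (potential n (ladder b \<rho> h H) (shift n y i) - potential n (ladder b \<rho> h H) y)))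
    \<le> exp (\<theta> * ((\<Sum>i=1..n. p i * (2 * ?J i)) - decay n (ladder b \<rho> h H) y))"
  proof (rule exp_mean_potential_shift[OF pv])
    fix i assume i: "i \<in> {1..n}"
    have J: "0 \<le> \<theta> * ?J i" "\<theta> * ?J i \<le> 1"
      using mult_left_mono[OF jump_ladder(2)[OF assms(1-4), of "y i"] \<theta>(1)] \<theta>(2)[OF i]
        mult_nonneg_nonneg[OF \<theta>(1) jump_ladder(1)[OF assms(1-4), of "y i"]] by linarith+
    then have "exp (\<theta> * ?J i) \<le> 1 + \<theta> * ?J i + (\<theta> * ?J i)\<^sup>2" by (intro exp_le_quadratic) 
    also have "(\<theta> * ?J i)\<^sup>2 \<le> \<theta> * ?J i" using J by (simp add: power2_eq_square mult_left_le)
    finally show "exp (\<theta> * ?J i) \<le> 1 + \<theta> * (2 * ?J i)" by simp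
  qed
  then show ?thesis by (simp add: sum_distrib_left mult_ac)
qed

text \<open>The minimum combines the strong concentration of the exponential function near its
equilibrium with the fast recovery of the linear one from bad states.\<close>

definition damped :: "nat \<Rightarrow> real \<Rightarrow> real" where
  "damped n x = min (exp (10 * ln n / n * (x - 6 * real n))) (x / n)"

lemma damped_le: "damped n x \<le> x / n" by (simp add: damped_def)

lemma damped_nonneg: "0 \<le> x \<Longrightarrow> 0 \<le> damped n x" by (simp add: damped_def)

text \<open>From 7 n on the linear branch is the smaller one, because 10 ln n (x/n - 6) is at least
  x/n - 1 there. A potential above 7 n is thus seen undiminished.\<close>

lemma damped_eq:
  assumes "3 \<le> n" "7 * real n \<le> x" shows "damped n x = x / n"
proof -
  have "1 \<le> ln (real n)" using assms ln_ge_iff[of "real n" 1] exp_le by linarith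
  have "0 \<le> x / n - 7" using assms by (simp add: field_simps)
  have "x / n \<le> 1 + 10 * (x / n - 6)" using \<open>0 \<le> x / n - 7\<close> by simp
  also have "\<dots> \<le> 1 + 10 * ln n * (x / n - 6)"
    using \<open>1 \<le> ln (real n)\<close> \<open>0 \<le> x / n - 7\<close> by (intro add_left_mono mult_right_mono) auto
  also have "\<dots> \<le> exp (10 * ln n * (x / n - 6))" by (rule exp_ge_add_one_self)
  also have "10 * ln n * (x / n - 6) = 10 * ln n / n * (x - 6 * real n)" using assms by (simp add: field_simps)
  finally show ?thesis by (simp add: damped_def)
qed

lemma sum_damped_le:
  assumes "\<And>i. i \<in> I \<Longrightarrow> 0 \<le> p i"
  shows "(\<Sum>i\<in>I. p i * damped n (x' i)) \<le> (\<Sum>i\<in>I. p i * x' i) / n" 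
    "(\<Sum>i\<in>I. p i * damped n (x' i)) \<le> exp (10 * ln n / n * (x - 6 * real n)) * (\<Sum>i\<in>I. p i * exp (10 * ln n / n * (x' i - x)))"
proof -
  have "(\<Sum>i\<in>I. p i * damped n (x' i)) \<le> (\<Sum>i\<in>I. p i * (x' i / n))"
    using assms by (intro sum_mono mult_left_mono) (auto simp: damped_def)
  then show "(\<Sum>i\<in>I. p i * damped n (x' i)) \<le> (\<Sum>i\<in>I. p i * x' i) / n" by (simp add: sum_divide_distrib)
  have "(\<Sum>i\<in>I. p i * damped n (x' i)) \<le> (\<Sum>i\<in>I. p i * exp (10 * ln n / n * (x' i - 6 * real n)))"
    using assms by (intro sum_mono mult_left_mono) (auto simp: damped_def)
  also have "\<dots> = exp (10 * ln n / n * (x - 6 * real n)) * (\<Sum>i\<in>I. p i * exp (10 * ln n / n * (x' i - x)))"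
    unfolding sum_distrib_left
  proof (rule sum.cong)
    fix i
    have "10 * ln n / n * (x' i - 6 * real n) = 10 * ln n / n * (x - 6 * real n) + 10 * ln n / n * (x' i - x)"
      unfolding distrib_left[symmetric] by simp
    then show "p i * exp (10 * ln n / n * (x' i - 6 * real n)) =
        exp (10 * ln n / n * (x - 6 * real n)) * (p i * exp (10 * ln n / n * (x' i - x)))"
      by (simp only: exp_add mult_ac)
  qed simp
  finally show "(\<Sum>i\<in>I. p i * damped n (x' i)) \<le> exp (10 * ln n / n * (x - 6 * real n)) * (\<Sum>i\<in>I. p i * exp (10 * ln n / n * (x' i - x)))" .
qed

text \<open>From 5 n on the drift X is at most -b x/(20 n), and both branches contract. Below 5 n
  the exponential branch is at most n^(-10), as the reference point 6 n lies n higher, and it at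
  most doubles in one step.\<close>

lemma damped_contraction:
  assumes p: "\<And>i. i \<in> I \<Longrightarrow> 0 \<le> p i" and x: "0 \<le> x" and n: "3 \<le> n" "10 * ln n \<le> n" and b: "0 < b" "b \<le> 1 / 50"
    and X: "X \<le> b / n * (n / 2 - 15 / 100 * x)"
    and mean: "(\<Sum>i\<in>I. p i * x' i) \<le> x + X"
    and emean: "(\<Sum>i\<in>I. p i * exp (10 * ln n / n * (x' i - x))) \<le> exp (10 * ln n / n * X)"
  shows "(\<Sum>i\<in>I. p i * damped n (x' i)) \<le> (1 - b / (50 * real n)) * damped n x + 2 / real n ^ 10"
proof -
  let ?S = "(\<Sum>i\<in>I. p i * damped n (x' i))"
  define \<theta> where "\<theta> = 10 * ln n / n"
  have ln1: "1 \<le> ln (real n)" using n ln_ge_iff[of "real n" 1] exp_le by linarith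
  have \<theta>: "0 < \<theta>" "\<theta> \<le> 1" "10 / n \<le> \<theta>" using ln1 n by (auto simp: \<theta>_def field_simps)
  have S1: "?S \<le> (x + X) / n"
    using sum_damped_le(1)[of I p n x'] p mean n by (auto simp: divide_right_mono intro: order_trans)
  have S2: "?S \<le> exp (\<theta> * (x - 6 * real n)) * exp (\<theta> * X)"
  proof -
    have "?S \<le> exp (\<theta> * (x - 6 * real n)) * (\<Sum>i\<in>I. p i * exp (\<theta> * (x' i - x)))"
      using sum_damped_le(2)[of I p n x' x] p unfolding \<theta>_def by blast
    also have "\<dots> \<le> exp (\<theta> * (x - 6 * real n)) * exp (\<theta> * X)"
      using emean unfolding \<theta>_def[symmetric] by (intro mult_left_mono) auto
    finally show ?thesis .
  qed
  have bn: "0 \<le> b / n" using b by simp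
  show ?thesis
  proof (cases "5 * real n \<le> x")
    case True
    have "n / 2 - 15 / 100 * x \<le> - (5 / 100) * x" using True by simp
    then have "b / n * (n / 2 - 15 / 100 * x) \<le> b / n * (- (5 / 100) * x)" using b by (intro mult_left_mono) auto
    with X have X1: "X \<le> - (b / n * (5 / 100)) * x" by simp
    have "b / n * (5 / 100) * (5 * real n) \<le> b / n * (5 / 100) * x" using True b by (intro mult_left_mono) auto
    with X1 have X2: "X \<le> - b / 4" using n by simp
    have A: "?S \<le> (1 - b / (50 * real n)) * (x / n)"
    proof -
      have "x + X \<le> (1 - b / (50 * real n)) * x"
      proof -
        have "b / (50 * real n) \<le> b / n * (5 / 100)" using b n by (simp add: field_simps)
        then have "b / (50 * real n) * x \<le> b / n * (5 / 100) * x" using x by (rule mult_right_mono)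
        with X1 show ?thesis by (simp add: left_diff_distrib)
      qed
      then show ?thesis using S1 n by (simp add: divide_right_mono order_trans)
    qed
    have B: "?S \<le> (1 - b / (50 * real n)) * exp (\<theta> * (x - 6 * real n))"
    proof -
      have "\<theta> * X \<le> \<theta> * (- b / 4)" using X2 \<theta> by (intro mult_left_mono) auto
      then have "exp (\<theta> * X) \<le> exp (- (\<theta> * b / 4))" by simp
      also have "\<dots> \<le> 1 + (- (\<theta> * b / 4)) + (\<theta> * b / 4)\<^sup>2"
      proof -
        have "0 \<le> \<theta> * b" using \<theta> b by simp
        then show ?thesis using exp_le_quadratic[of "- (\<theta> * b / 4)"] by simp
      qed
      also have "(\<theta> * b / 4)\<^sup>2 \<le> (\<theta> * b / 4) / 2"
      proof -
        have "\<theta> * b \<le> 1 * 1" using \<theta> b by (intro mult_mono) auto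
        then have "(\<theta> * b / 4) * (\<theta> * b / 4) \<le> (\<theta> * b / 4) * (1 / 2)" using \<theta> b by (intro mult_left_mono) auto
        then show ?thesis by (simp add: power2_eq_square)
      qed
      also have "1 + - (\<theta> * b / 4) + \<theta> * b / 4 / 2 = 1 - \<theta> * b / 8" by simp
      also have "\<dots> \<le> 1 - b / (50 * real n)"
        using mult_right_mono[OF \<theta>(3), of b] b n by (simp add: field_simps)
      finally have "exp (\<theta> * (x - 6 * real n)) * exp (\<theta> * X) \<le> exp (\<theta> * (x - 6 * real n)) * (1 - b / (50 * real n))"
        by (intro mult_left_mono) auto
      then show ?thesis using S2 by (simp only: mult.commute order_trans)
    qed
    have "?S \<le> (1 - b / (50 * real n)) * damped n x"
      using A B unfolding damped_def \<theta>_def[symmetric] by (simp add: min_def)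
    moreover have "0 \<le> 2 / real n ^ 10" by simp
    ultimately show ?thesis by linarith
  next
    case False
    have "b / n * (n / 2 - 15 / 100 * x) \<le> b / n * (n / 2)" using x b by (intro mult_left_mono) auto
    with X have "X \<le> b / 2" using n by simp
    then have "\<theta> * X \<le> \<theta> * (b / 2)" using \<theta> by (intro mult_left_mono) auto
    also have "\<dots> \<le> 1 * (1 / 2)" using \<theta> b by (intro mult_mono) auto
    finally have "exp (\<theta> * X) \<le> exp (1 / 2)" by simp
    also have "\<dots> \<le> 1 + 1/2 + (1/2)\<^sup>2" by (rule exp_le_quadratic) auto
    also have "\<dots> \<le> 2" by (simp add: power2_eq_square)
    finally have e1: "exp (\<theta> * X) \<le> 2" .
    have "\<theta> * (x - 6 * real n) \<le> \<theta> * (- n)" using False \<theta> by (intro mult_left_mono) auto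
    also have "\<dots> = - (10 * ln n)" using n by (simp add: \<theta>_def)
    finally have "exp (\<theta> * (x - 6 * real n)) \<le> exp (- (10 * ln n))" by simp
    also have "exp (- (10 * ln n)) = 1 / real n ^ 10"
    proof -
      have "exp (real 10 * ln n) = real n ^ 10" unfolding exp_of_nat_mult using n by simp
      then show ?thesis by (simp add: exp_minus field_simps)
    qed
    finally have "exp (\<theta> * (x - 6 * real n)) * exp (\<theta> * X) \<le> (1 / real n ^ 10) * 2"
      using e1 by (intro mult_mono) auto
    moreover have "0 \<le> (1 - b / (50 * real n)) * damped n x"
      using b n x by (intro mult_nonneg_nonneg damped_nonneg) (auto simp: field_simps)
    ultimately show ?thesis using S2 by simp
  qed
qed

section \<open>The allocation probabilities\<close>

lemma pmf_quantile_step: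
  fixes n k :: nat and \<delta> :: "nat \<Rightarrow> real" and rk :: "nat \<Rightarrow> nat"
  defines "idx \<equiv> \<lambda>i. quantile_index n k \<delta> (rk i)"
  assumes i: "i \<in> {1..n}"
  shows "pmf (quantile_step n k \<delta> rk) i =
    (card {j\<in>{1..n}. idx j < idx i} + card {j\<in>{1..n}. idx j \<le> idx i}) / (real n)\<^sup>2"
proof -
  define w :: "nat \<Rightarrow> real" where "w j = (of_bool (idx j < idx i) + of_bool (idx j \<le> idx i)) / 2" for j
  have fin: "finite {1..n}" "{1..n} \<noteq> {}" using i by auto
  define sel where "sel a b = (if idx a > idx b then return_pmf a else if idx a < idx b then return_pmf b
     else pmf_of_set {a, b})" for a b
  \<comment> \<open>\<open>w j\<close> is the chance that bin \<open>i\<close> wins against sample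
    \<open>j\<close>: 1, 1/2 or 0. If both samples equal \<open>i\<close>, each summand gives
    1/2.\<close>
  have sel: "pmf (sel a b) i = of_bool (a = i) * w b + of_bool (b = i) * w a" for a b
    by (auto simp: sel_def w_def indicator_def)
  have "quantile_step n k \<delta> rk = pmf_of_set {1..n} \<bind> (\<lambda>a. pmf_of_set {1..n} \<bind> (\<lambda>b. sel a b))"
    unfolding quantile_step_def sel_def idx_def Let_def ..
  then have "pmf (quantile_step n k \<delta> rk) i = 
     (\<Sum>a\<in>{1..n}. \<Sum>b\<in>{1..n}. pmf (sel a b) i) / (real n * real n)"
    using fin by (simp add: pmf_bind integral_pmf_of_set)
  also have "\<dots> = (\<Sum>a=1..n. \<Sum>b=1..n. of_bool (a = i) * w b + of_bool (b = i) * w a) / (real n)\<^sup>2"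
    unfolding sel power2_eq_square ..
  also have "(\<Sum>a=1..n. \<Sum>b=1..n. of_bool (a = i) * w b + of_bool (b = i) * w a) = 2 * (\<Sum>b=1..n. w b)"
  proof -
    have delta: "(\<Sum>b=1..n. of_bool (b = i) * f b) = f i" for f :: "nat \<Rightarrow> real"
    proof -
      have "(\<Sum>b=1..n. of_bool (b = i) * f b) = (\<Sum>b=1..n. if b = i then f b else 0)"
        by (rule sum.cong) auto
      then show ?thesis using i by simp
    qed
    show ?thesis by (simp only: sum.distrib sum_distrib_left[symmetric] delta mult_2)
  qed
  also have "2 * (\<Sum>b=1..n. w b) = (\<Sum>b=1..n. of_bool (idx b < idx i) + of_bool (idx b \<le> idx i))"
    unfolding sum_distrib_left w_def by (rule sum.cong) auto
  also have "\<dots> = card {j\<in>{1..n}. idx j < idx i} + card {j\<in>{1..n}. idx j \<le> idx i}"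
    by (simp add: sum.distrib of_bool_def sum.If_cases Int_def)
  finally show ?thesis .
qed

lemma set_pmf_quantile_step:
  assumes "1 \<le> n" shows "set_pmf (quantile_step n k \<delta> rk) \<subseteq> {1..n}"
  using assms by (auto simp: quantile_step_def Let_def set_pmf_of_set split: if_splits)

text \<open>Counts \<open>c l\<close> of bins replace the real thresholds. They are only weakly
  increasing: equal neighbours mean an empty rank class.\<close>

locale quantiles =
  fixes n k :: nat and \<delta> :: "nat \<Rightarrow> real" and c :: "nat \<Rightarrow> nat" and rk :: "nat \<Rightarrow> nat" and y :: "nat \<Rightarrow> real"
  assumes n: "1 \<le> n" and \<delta>: "\<And>l. 1 \<le> l \<Longrightarrow> l \<le> k \<Longrightarrow> \<delta> l = real (c l) / real n"
    and mono: "\<And>l l'. 1 \<le> l \<Longrightarrow> l \<le> l' \<Longrightarrow> l' \<le> k \<Longrightarrow> c l \<le> c l'" and ck: "c k \<le> n"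
    and bij: "bij_betw rk {1..n} {1..n}"
    and ranked: "\<And>i j. i \<in> {1..n} \<Longrightarrow> j \<in> {1..n} \<Longrightarrow> y j < y i \<Longrightarrow> rk i < rk j"
begin

definition bound :: "nat \<Rightarrow> nat" where
  "bound l = (if l = 0 then 0 else if l \<le> k then c l else n)"

lemma quantile_bound: "quantile_bound k \<delta> l * real n = real (bound l)"
  using n \<delta>[of l] by (simp add: quantile_bound_def bound_def)

lemma bound_mono: "l \<le> l' \<Longrightarrow> bound l \<le> bound l'"
  unfolding bound_def using mono[of l l'] mono[of l k] ck by auto

text \<open>Monotone bounds make the definite description in \<open>quantile_index\<close> well
  defined; its value is the least class whose upper bound reaches the rank.\<close>

lemma quantile_index_less:
  assumes "r \<in> {1..n}" "l \<le> k + 1"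
  shows "quantile_index n k \<delta> r < l \<longleftrightarrow> r \<le> bound l"
proof -
  define l0 where "l0 = (LEAST l. r \<le> bound (l + 1))"
  have k: "r \<le> bound (k + 1)" using assms by (simp add: bound_def)
  have up: "r \<le> bound (l0 + 1)" unfolding l0_def using k by (rule LeastI)
  have l0k: "l0 \<le> k" unfolding l0_def using k by (rule Least_le)
  have lo: "bound l0 < r"
  proof (cases l0)
    case 0 then show ?thesis using assms by (simp add: bound_def)
  next
    case (Suc m)
    then have "m < (LEAST l. r \<le> bound (l + 1))" by (simp add: l0_def)
    then have "\<not> r \<le> bound (m + 1)" by (rule not_less_Least)
    then show ?thesis using Suc by simp
  qed
  have "quantile_index n k \<delta> r = l0"
    unfolding quantile_index_def quantile_bound
  proof (rule the_equality)
    show "l0 \<le> k \<and> real r \<in> {real (bound l0)<..real (bound (l0 + 1))}" using l0k lo up by simp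
    fix l assume "l \<le> k \<and> real r \<in> {real (bound l)<..real (bound (l + 1))}"
    then have l: "bound l < r" "r \<le> bound (l + 1)" by auto
    show "l = l0"
    proof (rule ccontr)
      assume "l \<noteq> l0"
      then have "l + 1 \<le> l0 \<or> l0 + 1 \<le> l" by linarith
      then show False using l lo up bound_mono[of "l + 1" l0] bound_mono[of "l0 + 1" l] by linarith
    qed
  qed
  then show ?thesis using lo up bound_mono[of "l0 + 1" l] bound_mono[of l l0] by (cases "l0 < l") auto
qed

lemma rk_in: "i \<in> {1..n} \<Longrightarrow> rk i \<in> {1..n}"
  using bij by (auto simp: bij_betw_def)

lemma card_rank_le:
  assumes "m \<le> n" shows "card {i\<in>{1..n}. rk i \<le> m} = m"
proof -
  have inj: "inj_on rk {1..n}" and im: "rk ` {1..n} = {1..n}" using bij by (simp_all add: bij_betw_def)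
  have "rk ` {i\<in>{1..n}. rk i \<le> m} = {r \<in> rk ` {1..n}. r \<le> m}" by blast
  also have "\<dots> = {1..m}" unfolding im using assms by auto
  finally have "card (rk ` {i\<in>{1..n}. rk i \<le> m}) = m" by simp
  moreover have "inj_on rk {i\<in>{1..n}. rk i \<le> m}" using inj by (rule inj_on_subset) auto
  ultimately show ?thesis using card_image by fastforce
qed

definition prob :: "nat \<Rightarrow> real" where
  "prob i = pmf (quantile_step n k \<delta> rk) i"

lemma card_index_less:
  assumes "l \<le> k + 1" shows "card {j\<in>{1..n}. quantile_index n k \<delta> (rk j) < l} = bound l"
proof -
  have "{j\<in>{1..n}. quantile_index n k \<delta> (rk j) < l} = {j\<in>{1..n}. rk j \<le> bound l}"
    using quantile_index_less[OF rk_in assms] by blast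
  moreover have "bound l \<le> n" using bound_mono[of l "k + 1"] assms by (simp add: bound_def)
  ultimately show ?thesis using card_rank_le by simp
qed

lemma prob_eq:
  assumes i: "i \<in> {1..n}"
  obtains l where "l \<le> k" "bound l < rk i" "rk i \<le> bound (l + 1)" 
    "prob i = (real (bound l) + real (bound (l + 1))) / (real n)\<^sup>2"
proof -
  define l where "l = quantile_index n k \<delta> (rk i)"
  have lk: "l \<le> k" using quantile_index_less[OF rk_in[OF i], of "k + 1"] rk_in[OF i] by (simp add: l_def bound_def)
  have "prob i = (card {j\<in>{1..n}. quantile_index n k \<delta> (rk j) < l} + 
      card {j\<in>{1..n}. quantile_index n k \<delta> (rk j) < l + 1}) / (real n)\<^sup>2"
    unfolding prob_def pmf_quantile_step[OF i] l_def by (simp add: less_Suc_eq_le)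
  also have "\<dots> = (real (bound l) + real (bound (l + 1))) / (real n)\<^sup>2"
    using lk by (simp only: card_index_less of_nat_add)
  finally show ?thesis
    using that[of l] lk quantile_index_less[OF rk_in[OF i], of l] quantile_index_less[OF rk_in[OF i], of "l + 1"]
    by (auto simp: l_def)
qed

lemma prob_vector_prob: "prob_vector n prob"
proof -
  have "(\<Sum>i=1..n. prob i) = 1"
    unfolding prob_def using set_pmf_quantile_step[OF n] by (intro sum_pmf_eq_1) auto
  then show ?thesis by (simp add: prob_vector_def prob_def)
qed

lemma prob_le_bound:
  assumes i: "i \<in> {1..n}" and "rk i \<le> bound l"
  shows "prob i \<le> 2 * real (bound l) / (real n)\<^sup>2"
proof -
  obtain l' where l': "bound l' < rk i" "prob i = (real (bound l') + real (bound (l' + 1))) / (real n)\<^sup>2"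
    using prob_eq[OF i] by metis
  then have "l' + 1 \<le> l" using bound_mono[of l l'] assms by (cases "l' + 1 \<le> l") auto
  then have "bound l' \<le> bound l" "bound (l' + 1) \<le> bound l" using bound_mono[of l' l] bound_mono[of "l' + 1" l] by auto
  then show ?thesis unfolding l' by (intro divide_right_mono) auto
qed

lemma prob_le: "i \<in> {1..n} \<Longrightarrow> prob i \<le> 2 / n"
  using prob_le_bound[of i "k + 1"] rk_in[of i] n by (simp add: bound_def power2_eq_square)

text \<open>Every bin ranked no worse than \<open>i\<close> has at least its load, hence also
  exceeds \<open>z\<close>; so few bins above \<open>z\<close> force a rank of at most
  \<open>c l\<close>.\<close>

lemma prob_le_level:
  assumes l: "1 \<le> l" "l \<le> k" and cd: "card {i\<in>{1..n}. z < y i} \<le> c l" and i: "i \<in> {1..n}" "z < y i"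
  shows "prob i \<le> 2 * real (c l) / (real n)\<^sup>2"
proof -
  have "{j\<in>{1..n}. rk j \<le> rk i} \<subseteq> {i\<in>{1..n}. z < y i}"
    using i ranked[of i] by fastforce
  then have "card {j\<in>{1..n}. rk j \<le> rk i} \<le> card {i\<in>{1..n}. z < y i}" by (intro card_mono) auto
  then have "rk i \<le> c l" using card_rank_le[of "rk i"] rk_in[OF i(1)] cd by auto
  then show ?thesis using prob_le_bound[of i l] i l by (simp add: bound_def)
qed

text \<open>\<open>T\<close> consists of the first \<open>c k\<close> ranks and \<open>i0\<close> is
  the bin of rank exactly \<open>c k\<close>. Beyond \<open>T\<close> only the last class remains,
  where the probability is (c k + n)/n^2 \<ge> (3/2)/n.\<close>

lemma top_half_prob:
  assumes k: "2 \<le> k" and half: "n \<le> 2 * c k" "2 * c k \<le> n + 1" and small: "100 * (c (k - 1) + c k) \<le> 51 * n"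
  shows "\<exists>T i0. top_half n prob y T i0"
proof -
  define T where "T = {i\<in>{1..n}. rk i \<le> c k}"
  have "c k \<in> rk ` {1..n}" using bij half n ck by (auto simp: bij_betw_def)
  then obtain i0 where i0: "i0 \<in> {1..n}" "rk i0 = c k" by auto
  have "top_half n prob y T i0"
    unfolding top_half_def
  proof (intro conjI ballI)
    show "T \<subseteq> {1..n}" "i0 \<in> T" using i0 by (auto simp: T_def)
    have "card T = c k" unfolding T_def using ck by (rule card_rank_le)
    then show "n \<le> 2 * card T" "2 * card T \<le> n + 1" using half by simp_all
  next
    fix i assume i: "i \<in> T"
    then have iI: "i \<in> {1..n}" by (simp add: T_def)
    show "y i0 \<le> y i"
    proof (rule ccontr)
      assume "\<not> y i0 \<le> y i"
      then have "rk i0 < rk i" using ranked[of i0 i] iI i0 by auto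
      then show False using i i0 by (auto simp: T_def)
    qed
    obtain l where l: "l \<le> k" "bound l < rk i" "prob i = (real (bound l) + real (bound (l + 1))) / (real n)\<^sup>2"
      using prob_eq[OF iI] by metis
    have "l \<noteq> k" using l(2) i k by (auto simp: T_def bound_def)
    then have "l \<le> k - 1" using l(1) by simp
    then have "bound l \<le> c (k - 1)" "bound (l + 1) \<le> c k" 
      using bound_mono[of l "k - 1"] bound_mono[of "l + 1" k] k by (auto simp: bound_def)
    then have "bound l + bound (l + 1) \<le> c (k - 1) + c k" by (rule add_mono)
    then have "100 * (bound l + bound (l + 1)) \<le> 51 * n"
      using small by (meson mult_le_mono2 order_trans)
    then have "real (100 * (bound l + bound (l + 1))) \<le> real (51 * n)" by (rule of_nat_mono)
    then have "real (bound l) + real (bound (l + 1)) \<le> 51 / 100 * real n" by simp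
    then have "prob i \<le> (51 / 100 * real n) / (real n)\<^sup>2" unfolding l by (rule divide_right_mono) simp
    then show "prob i \<le> 51 / 100 / n" using n by (simp add: power2_eq_square)
  next
    fix i assume i: "i \<in> {1..n} - T"
    then have iI: "i \<in> {1..n}" by simp
    show "y i \<le> y i0"
    proof (rule ccontr)
      assume "\<not> y i \<le> y i0"
      then have "rk i < rk i0" using ranked[of i i0] i i0 by auto
      then show False using i i0 by (auto simp: T_def)
    qed
    obtain l where l: "l \<le> k" "rk i \<le> bound (l + 1)" "prob i = (real (bound l) + real (bound (l + 1))) / (real n)\<^sup>2"
      using prob_eq[OF iI] by metis
    have "k \<le> l" using l i k bound_mono[of "l + 1" k] by (cases "k \<le> l") (auto simp: T_def bound_def)
    then have "l = k" using l by simp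
    then have "bound l = c k" "bound (l + 1) = n" using k by (simp_all only: bound_def) simp_all
    then have "3 / 2 * real n \<le> real (bound l) + real (bound (l + 1))" using half by linarith
    then have "(3 / 2 * real n) / (real n)\<^sup>2 \<le> prob i" unfolding l by (rule divide_right_mono) simp
    then show "3 / 2 / n \<le> prob i" using n by (simp add: power2_eq_square)
  qed
  then show ?thesis by blast
qed

end

section \<open>The Lyapunov function\<close>

text \<open>\<open>Q\<close> is n^(1/4), the unit in which powers of n are counted, and
  \<open>N\<close> is the numerical factor between successive weights. The last assumption keeps the
  sum of all weights within \<open>Q\<close>, even after multiplication by exp (7 L^(j+1)).\<close>

locale large =
  fixes n k :: nat and L Q N :: real
  assumes k: "2 \<le> k" and L: "10 ^ 4 \<le> L" and ln_n: "ln (real n) = L ^ k" and n: "0 < n"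
    and Q: "0 < Q" "Q ^ 4 = real n" and N: "N = 4 * 10 ^ 8 * ln (real n)"
    and large: "real k * N ^ k * exp (15 * L ^ (k - 1)) \<le> Q"
begin

text \<open>The rate of layer 0 and of all ladders above their top; b * 1000 L = L makes layer 0
  large enough where layer 1 starts.\<close>

abbreviation b :: real where "b \<equiv> 1 / 1000"

text \<open>The rate for far loads, the largest one covered by \<open>two_sided_mean_drift\<close>.
  Since 500 (a - b) = 19/2, a load beyond 500 ln n makes exp (a x) outweigh exp (b x) by
  n^(19/2).\<close>

abbreviation a :: real where "a \<equiv> 1 / 50"

text \<open>Layer j \<ge> 1 occupies [\<open>height j\<close>, \<open>height (j + 1)\<close>]. The
  length 24 L turns the rate L^j/4 into a total exponent 6 L^(j+1), which is 6 ln n for j = k -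
  1.\<close>

definition height :: "nat \<Rightarrow> real" where
  "height j = 1000 * L + 24 * L * (real j - 1)"

definition \<phi> :: "nat \<Rightarrow> real \<Rightarrow> real" where
  "\<phi> j = (if j = 0 then two_sided b else ladder b (L ^ j / 4) (height j) (height (j + 1)))"

definition \<Phi> :: "nat \<Rightarrow> (nat \<Rightarrow> real) \<Rightarrow> real" where
  "\<Phi> j y = potential n (\<phi> j) y"

text \<open>For j = k - 1 the size factor exp (7 L^(j+1)) is n^7, too large for an exponential
  moment at scale n / ln n; the small weight of this layer makes the linear form affordable.\<close>

definition V :: "nat \<Rightarrow> (nat \<Rightarrow> real) \<Rightarrow> real" where
  "V j y = (if j < k - 1 then damped n (\<Phi> j y) else \<Phi> j y / n)"

text \<open>The terms -7 L^(j+1) provide between neighbours the factor exp (L^j + 6 L^(j+1)) by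
  which a bad layer can inflate the next one. They also make the last weight n^(-7) up to exp (14
  L^(k-1)).\<close>

definition w :: "nat \<Rightarrow> real" where
  "w j = N ^ (k - 1 - j) * exp (14 * L ^ (k - 1) - 7 * L ^ (j + 1))"

definition W :: "(nat \<Rightarrow> real) \<Rightarrow> real" where
  "W y = (\<Sum>j<k. w j * V j y) + potential n (two_sided a) y / Q ^ 28"

text \<open>All that the drift estimates know about a step. The last clause is an implication about
  the current loads alone, with the level \<open>z\<close> left open: it can be verified in every
  state, and only its premise depends on the previous layer.\<close>

definition admissible :: "(nat \<Rightarrow> real) \<Rightarrow> (nat \<Rightarrow> real) \<Rightarrow> bool" where
  "admissible p y \<longleftrightarrow> prob_vector n p \<and> (\<forall>i\<in>{1..n}. p i \<le> 2 / n) \<and> (\<exists>T i0. top_half n p y T i0) \<and>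
     (\<Sum>i=1..n. y i) = 0 \<and>
     (\<forall>j z. 1 \<le> j \<and> j < k \<and> card {i\<in>{1..n}. z < y i} \<le> exp (- (ln 2 / 2) * L ^ j) * n \<longrightarrow>
        (\<forall>i\<in>{1..n}. z < y i \<longrightarrow> p i \<le> 4 / n * exp (- (ln 2 / 2) * L ^ j)))"

section \<open>Powers of L and n, heights and weights\<close>

lemma Lpow_ge: "1 \<le> j \<Longrightarrow> 10 ^ 4 \<le> L ^ j"
  using L power_increasing[of 1 j L] by simp

lemma Lpow_pos: "0 < L ^ j"
  using L by simp

lemma Lpow_Suc: "8 * L ^ j \<le> L ^ (j + 1)"
proof -
  have "8 \<le> L" using L by simp
  then have "8 * L ^ j \<le> L * L ^ j" using Lpow_pos[of j] by (intro mult_right_mono) auto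
  then show ?thesis by simp
qed

lemma Lpow_mono: "i \<le> j \<Longrightarrow> L ^ i \<le> L ^ j"
  using L by (intro power_increasing) auto

lemma ln_n_ge: "10 ^ 8 \<le> ln (real n)"
proof -
  have "(10 ^ 4) ^ 2 \<le> L ^ 2" using L by (intro power_mono) auto
  also have "\<dots> \<le> L ^ k" using k by (rule Lpow_mono)
  finally show ?thesis by (simp add: ln_n)
qed

lemma n_ge: "10 ^ 8 \<le> n"
proof -
  have "10 ^ 8 \<le> real n" using ln_n_ge ln_less_self[of "real n"] n by linarith
  then have "real (10 ^ 8) \<le> real n" by simp
  then show ?thesis by (simp only: of_nat_le_iff)
qed

lemma N_ge: "10 ^ 16 \<le> N" using ln_n_ge by (simp add: N)

lemma exp_N_le_Q: "exp (15 * L ^ (k - 1)) \<le> Q" "N \<le> Q" "N ^ k * real k \<le> Q"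
proof -
  have N1: "1 \<le> N ^ k" using N_ge by simp
  have "1 * 1 \<le> real k * N ^ k" using k N1 by (intro mult_mono) auto
  then have "1 * exp (15 * L ^ (k - 1)) \<le> real k * N ^ k * exp (15 * L ^ (k - 1))"
    by (intro mult_right_mono) auto
  then show "exp (15 * L ^ (k - 1)) \<le> Q" using large by linarith
  have "1 \<le> exp (15 * L ^ (k - 1))" using L by simp
  then have "(real k * N ^ k) * 1 \<le> real k * N ^ k * exp (15 * L ^ (k - 1))"
    using k N1 by (intro mult_left_mono) auto
  then show *: "N ^ k * real k \<le> Q" using large by (simp add: mult.commute)
  have "N * 1 \<le> N ^ k * real k" using k N_ge self_le_power[of N k] by (intro mult_mono) auto
  then show "N \<le> Q" using * by simp
qed

lemma Q_ge: "10 ^ 16 \<le> Q" using exp_N_le_Q N_ge by simp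

lemma exp_L_le_Q: "j \<le> k - 1 \<Longrightarrow> c \<le> 15 \<Longrightarrow> 0 \<le> c \<Longrightarrow> exp (c * L ^ j) \<le> Q"
  using exp_N_le_Q(1) mult_mono[of c 15 "L ^ j" "L ^ (k - 1)"] Lpow_mono[of j "k - 1"] Lpow_pos[of j]
  by (smt (verit) exp_le_cancel_iff)

lemma exp_ln_n: "exp (real m / 4 * ln (real n)) = Q ^ m"
proof -
  have "ln (real n) = 4 * ln Q" using Q by (metis ln_realpow of_nat_numeral)
  then have "exp (real m / 4 * ln (real n)) = exp (real m * ln Q)" by simp
  also have "\<dots> = Q ^ m" using Q by (simp add: exp_of_nat_mult)
  finally show ?thesis .
qed

lemma ln_n_le: "4 * 10 ^ 8 * ln (real n) \<le> Q"
  using exp_N_le_Q(2) by (simp add: N)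

lemma height_diff: "height (Suc j) = height j + 24 * L"
  by (simp add: height_def algebra_simps)

lemma height_le: "height j \<le> height (j + 1)"
  using L by (simp add: height_diff)

lemma rate_ge: "b \<le> L ^ j / 4" "0 \<le> L ^ j / 4"
proof -
  have "1 \<le> L ^ j" using L by (intro one_le_power) auto
  then show "b \<le> L ^ j / 4" "0 \<le> L ^ j / 4" by simp_all
qed

lemma \<phi>_Suc: "1 \<le> j \<Longrightarrow> \<phi> j = ladder b (L ^ j / 4) (height j) (height (j + 1))"
  by (simp add: \<phi>_def)

lemma \<phi>_pos: "0 < \<phi> j x"
  by (simp add: \<phi>_def ladder_pos two_sided_def)

lemma \<Phi>_pos: "0 < \<Phi> j y"
  unfolding \<Phi>_def potential_def using n by (intro sum_pos \<phi>_pos) auto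

lemma V_nonneg: "0 \<le> V j y"
  using \<Phi>_pos[of j y] by (simp add: V_def damped_nonneg)

lemma V_le: "V j y \<le> \<Phi> j y / n"
  by (simp add: V_def damped_le)

lemma w_pos: "0 < w j"
  using N_ge by (simp add: w_def)

lemma exp_le_two_sided: "exp (b * max 0 (x - height j)) \<le> two_sided b x" if "1 \<le> j" for j
proof -
  have "0 \<le> height j" using that L by (simp add: height_def)
  then have "exp (b * max 0 (x - height j)) \<le> exp (b * \<bar>x\<bar>)" by simp
  also have "\<dots> \<le> two_sided b x" by (auto simp: two_sided_eq abs_if)
  finally show ?thesis .
qed

lemma \<phi>_le_exp:
  assumes "1 \<le> j" shows "\<phi> j x \<le> exp (6 * L ^ (j + 1)) * exp (b * max 0 (x - height (j + 1)))"
proof -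
  have "max 0 (min x (height (j + 1)) - height j) \<le> 24 * L" using L by (simp add: height_diff)
  then have "L ^ j / 4 * max 0 (min x (height (j + 1)) - height j) \<le> L ^ j / 4 * (24 * L)"
    using Lpow_pos[of j] by (intro mult_left_mono) auto
  also have "\<dots> = 6 * L ^ (j + 1)" by simp
  finally show ?thesis using assms unfolding \<phi>_Suc[OF assms] ladder_def exp_add[symmetric] by simp
qed

text \<open>Above \<open>height (j + 1)\<close> layer j grows at rate \<open>b\<close>, and so at
  least does layer j - 1, which has a lower top. Below, the whole climb costs at most exp (6
  L^(j+1)).\<close>

lemma \<phi>_le_previous:
  assumes "1 \<le> j" shows "\<phi> j x \<le> exp (6 * L ^ (j + 1)) * \<phi> (j - 1) x"
proof -
  have "exp (b * max 0 (x - height (j + 1))) \<le> \<phi> (j - 1) x"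
  proof (cases "j = 1")
    case True
    then show ?thesis using exp_le_two_sided[of "j + 1" x] by (simp add: \<phi>_def)
  next
    case False
    then have j: "1 \<le> j - 1" "j - 1 + 1 = j" using assms by auto
    have "b * max 0 (x - height (j + 1)) \<le> b * max 0 (x - height j)"
      using height_le[of j] by (intro mult_left_mono) auto
    also have "\<dots> \<le> L ^ (j - 1) / 4 * max 0 (min x (height j) - height (j - 1)) + b * max 0 (x - height j)"
      using Lpow_pos[of "j - 1"] by simp
    finally show ?thesis unfolding \<phi>_Suc[OF j(1)] ladder_def exp_le_cancel_iff j(2) .
  qed
  then show ?thesis using \<phi>_le_exp[OF assms, of x] by (meson exp_ge_zero mult_left_mono order_trans)
qed

lemma \<phi>_le_base: "\<phi> j x \<le> exp (6 * L ^ (j + 1)) * two_sided b x"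
proof (cases "j = 0")
  case True
  have "1 * two_sided b x \<le> exp (6 * L ^ (j + 1)) * two_sided b x"
    using L by (intro mult_right_mono) (auto simp: two_sided_def)
  then show ?thesis using True by (simp add: \<phi>_def)
next
  case False
  have "exp (6 * L ^ (j + 1)) * exp (b * max 0 (x - height (j + 1))) \<le> exp (6 * L ^ (j + 1)) * two_sided b x"
    using exp_le_two_sided[of "j + 1" x] by (intro mult_left_mono) auto
  then show ?thesis using \<phi>_le_exp[of j x] False by linarith
qed

lemma two_sided_le: "two_sided \<beta> x \<le> 2 * exp (\<beta> * \<bar>x\<bar>)" if "0 \<le> \<beta>" for \<beta> x
proof -
  have "\<beta> * x \<le> \<beta> * \<bar>x\<bar>" "- (\<beta> * x) \<le> \<beta> * \<bar>x\<bar>" using that mult_left_mono[of x "\<bar>x\<bar>" \<beta>] mult_left_mono[of "-x" "\<bar>x\<bar>" \<beta>] by auto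
  then show ?thesis unfolding two_sided_eq using exp_le_cancel_iff by (smt (verit))
qed

lemma \<Phi>_le_previous:
  assumes "1 \<le> j" shows "\<Phi> j y \<le> exp (6 * L ^ (j + 1)) * \<Phi> (j - 1) y"
  unfolding \<Phi>_def potential_def sum_distrib_left using assms by (intro sum_mono \<phi>_le_previous)

lemma \<phi>_shift_le:
  assumes "-1 \<le> d" "d \<le> 1" shows "\<phi> j (x + d) \<le> exp (L ^ j) * \<phi> j x"
proof (cases "j = 0")
  case True
  have "two_sided b (x + d) \<le> exp 1 * two_sided b x"
    unfolding two_sided_eq distrib_left exp_add[symmetric]
    using assms by (intro add_mono) auto
  then show ?thesis using True by (simp add: \<phi>_def)
next
  case False
  then have j: "1 \<le> j" by simp
  have "\<phi> j (x + d) \<le> \<phi> j (x + 1)" unfolding \<phi>_Suc[OF j] using assms rate_ge by (intro ladder_mono) auto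
  also have "\<dots> \<le> exp (L ^ j / 4 * 1) * \<phi> j x" 
    unfolding \<phi>_Suc[OF j] using rate_ge height_le by (intro ladder_growth) auto
  also have "\<dots> \<le> exp (L ^ j) * \<phi> j x" using rate_ge[of j] \<phi>_pos[of j x] by (intro mult_right_mono) auto
  finally show ?thesis .
qed

text \<open>A crude bound that uses no drift, meant for states with a far load.\<close>

lemma \<Phi>_shift_le:
  assumes "\<And>i. i \<in> {1..n} \<Longrightarrow> \<bar>y i\<bar> \<le> Y" "i \<in> {1..n}"
  shows "\<Phi> j (shift n y i) \<le> n * (exp (7 * L ^ (j + 1)) * (2 * exp (b * Y)))"
proof -
  have "\<Phi> j (shift n y i) \<le> (\<Sum>l=1..n. exp (7 * L ^ (j + 1)) * (2 * exp (b * Y)))"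
    unfolding \<Phi>_def potential_def
  proof (intro sum_mono)
    fix l assume l: "l \<in> {1..n}"
    have "\<phi> j (shift n y i l) = \<phi> j (y l + (of_bool (l = i) - 1 / n))"
      by (simp add: shift_def add_diff_eq)
    also have "\<dots> \<le> exp (L ^ j) * \<phi> j (y l)" using n by (intro \<phi>_shift_le) (auto simp: field_simps)
    also have "\<dots> \<le> exp (L ^ j) * (exp (6 * L ^ (j + 1)) * two_sided b (y l))"
      by (intro mult_left_mono \<phi>_le_base) auto
    also have "\<dots> = exp (L ^ j + 6 * L ^ (j + 1)) * two_sided b (y l)" by (simp add: exp_add)
    also have "\<dots> \<le> exp (7 * L ^ (j + 1)) * (2 * exp (b * Y))"
    proof (intro mult_mono)
      show "exp (L ^ j + 6 * L ^ (j + 1)) \<le> exp (7 * L ^ (j + 1))" using Lpow_mono[of j "j + 1"] by simp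
      have "two_sided b (y l) \<le> 2 * exp (b * \<bar>y l\<bar>)" by (rule two_sided_le) simp
      also have "\<dots> \<le> 2 * exp (b * Y)" using assms(1)[OF l] by simp
      finally show "two_sided b (y l) \<le> 2 * exp (b * Y)" .
    qed (auto simp: two_sided_def)
    finally show "\<phi> j (shift n y i l) \<le> exp (7 * L ^ (j + 1)) * (2 * exp (b * Y))" .
  qed
  then show ?thesis by simp
qed

lemma w_exp_le:
  assumes "j < k" shows "w j * exp (7 * L ^ (j + 1)) \<le> N ^ k * exp (14 * L ^ (k - 1))"
proof -
  have "w j * exp (7 * L ^ (j + 1)) = N ^ (k - 1 - j) * exp (14 * L ^ (k - 1))"
    by (simp add: w_def exp_diff)
  also have "\<dots> \<le> N ^ k * exp (14 * L ^ (k - 1))"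
    using N_ge by (intro mult_right_mono power_increasing) auto
  finally show ?thesis .
qed

lemma sum_w_le: "(\<Sum>j<k. w j * exp (7 * L ^ (j + 1))) \<le> Q" "(\<Sum>j<k. w j) \<le> Q"
proof -
  have "(\<Sum>j<k. w j * exp (7 * L ^ (j + 1))) \<le> (\<Sum>j<k. N ^ k * exp (14 * L ^ (k - 1)))"
    by (intro sum_mono w_exp_le) auto
  also have "\<dots> = (real k * N ^ k) * exp (14 * L ^ (k - 1))" by simp
  also have "\<dots> \<le> (real k * N ^ k) * exp (15 * L ^ (k - 1))"
    using N_ge L by (intro mult_left_mono) auto
  finally show *: "(\<Sum>j<k. w j * exp (7 * L ^ (j + 1))) \<le> Q" using large by simp
  have "(\<Sum>j<k. w j * 1) \<le> (\<Sum>j<k. w j * exp (7 * L ^ (j + 1)))"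
    using w_pos L by (intro sum_mono mult_left_mono) (auto simp: less_imp_le)
  then show "(\<Sum>j<k. w j) \<le> Q" using * by simp
qed

text \<open>8 L^j \<le> L^(j+1) makes the exponents fit: L^j + 6 L^(j+1) - 7 L^(j+1) \<le> -7 L^j.
  The numerical factor is one \<open>N\<close>.\<close>

lemma w_previous:
  assumes "1 \<le> j" "j < k"
  shows "4 * 10 ^ 8 * ln n * exp (L ^ j + 6 * L ^ (j + 1)) * w j \<le> w (j - 1)"
proof -
  have j: "j - 1 + 1 = j" "k - 1 - (j - 1) = Suc (k - 1 - j)" using assms by auto
  have "exp (L ^ j + 6 * L ^ (j + 1)) * exp (14 * L ^ (k - 1) - 7 * L ^ (j + 1)) \<le> exp (14 * L ^ (k - 1) - 7 * L ^ j)"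
    unfolding exp_add[symmetric] exp_le_cancel_iff using Lpow_Suc[of j] by linarith
  then have "N ^ Suc (k - 1 - j) * (exp (L ^ j + 6 * L ^ (j + 1)) * exp (14 * L ^ (k - 1) - 7 * L ^ (j + 1)))
     \<le> N ^ Suc (k - 1 - j) * exp (14 * L ^ (k - 1) - 7 * L ^ j)"
    using N_ge by (intro mult_left_mono) auto
  then show ?thesis unfolding w_def j N[symmetric] power_Suc by (simp only: mult_ac)
qed

text \<open>For j = 1 this is b (1000 L - 1) \<ge> L/2. For larger j the previous ladder has climbed
  for at least 24 L - 1 \<ge> 2 L, and 2 L at rate L^(j-1)/4 already makes L^j/2. The -1 covers bins
  that the next ball can lift into the layer.\<close>

lemma \<phi>_ge:
  assumes "1 \<le> j" "height j - 1 < x" shows "exp (L ^ j / 2) \<le> \<phi> (j - 1) x"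
proof (cases "j = 1")
  case True
  have "L ^ j / 2 \<le> b * x" using assms L True by (simp add: height_def)
  then have "exp (L ^ j / 2) \<le> exp (b * x)" by simp
  also have "\<dots> \<le> two_sided b x" by (simp add: two_sided_eq)
  finally show ?thesis using True by (simp add: \<phi>_def)
next
  case False
  then have j: "1 \<le> j - 1" "j - 1 + 1 = j" using assms by auto
  have "height j = height (j - 1) + 24 * L" using height_diff[of "j - 1"] j by simp
  then have "2 * L \<le> max 0 (min x (height j) - height (j - 1))" using assms(2) L by (simp add: min_def max_def)
  then have "L ^ (j - 1) / 4 * (2 * L) \<le> L ^ (j - 1) / 4 * max 0 (min x (height j) - height (j - 1))"
    using Lpow_pos[of "j - 1"] by (intro mult_left_mono) auto
  also have "\<dots> \<le> L ^ (j - 1) / 4 * max 0 (min x (height j) - height (j - 1)) + b * max 0 (x - height j)" by simp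
  finally have "L ^ (j - 1) / 4 * (2 * L) \<le> \<dots>" .
  moreover have "L ^ (j - 1) / 4 * (2 * L) = L ^ j / 2"
    using power_add[of L "j - 1" 1] j by simp
  ultimately show ?thesis unfolding \<phi>_Suc[OF j(1)] ladder_def exp_le_cancel_iff j(2) by simp
qed

text \<open>Markov's inequality by counting; 1/2 > (ln 2)/2 and L^j \<ge> 10^4 swallow the constant
  7. For j < k the right-hand side is n times the quantile of index k - j before rounding.\<close>

lemma card_above_le:
  assumes j: "1 \<le> j" and good: "\<Phi> (j - 1) y \<le> 7 * n"
  shows "card {i\<in>{1..n}. height j - 1 < y i} \<le> exp (- (ln 2 / 2) * L ^ j) * n"
proof -
  let ?S = "{i\<in>{1..n}. height j - 1 < y i}"
  have "real (card ?S) * exp (L ^ j / 2) = (\<Sum>i\<in>?S. exp (L ^ j / 2))" by simp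
  also have "\<dots> \<le> (\<Sum>i\<in>?S. \<phi> (j - 1) (y i))" using j by (intro sum_mono \<phi>_ge) auto
  also have "\<dots> \<le> \<Phi> (j - 1) y"
    unfolding \<Phi>_def potential_def by (intro sum_mono2) (auto intro: less_imp_le \<phi>_pos)
  also have "\<dots> \<le> 7 * real n" using good by simp
  also have "\<dots> \<le> exp (L ^ j / 2 - ln 2 / 2 * L ^ j) * real n"
  proof (intro mult_right_mono)
    have "ln 2 / 2 * L ^ j \<le> (25 / 72) * L ^ j"
      using ln2_le_25_over_36 Lpow_pos[of j] by (intro mult_right_mono) auto
    moreover have "10000 \<le> L ^ j" using Lpow_ge[OF j] by simp
    ultimately have "6 \<le> L ^ j / 2 - ln 2 / 2 * L ^ j" by linarith
    then show "7 \<le> exp (L ^ j / 2 - ln 2 / 2 * L ^ j)"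
      using exp_ge_add_one_self[of "L ^ j / 2 - ln 2 / 2 * L ^ j"] by linarith
  qed simp
  also have "\<dots> = exp (- (ln 2 / 2) * L ^ j) * n * exp (L ^ j / 2)" by (simp add: exp_add[symmetric])
  finally show ?thesis by simp
qed

text \<open>As (ln 2)/2 > 1/4, the small probability of hitting layer j outweighs the growth exp
  (L^j/4) per ball; L^j \<ge> 10^4 leaves room for the constants.\<close>

lemma exp_decay_le:
  assumes "1 \<le> j" shows "4 / n * exp (- (ln 2 / 2) * L ^ j) * exp (L ^ j / 4) \<le> b / (40 * n)"
proof -
  define t where "t = (ln 2 / 2) * L ^ j - L ^ j / 4"
  have "1 / 3 * L ^ j \<le> ln 2 / 2 * L ^ j"
    using ln2_ge_two_thirds Lpow_pos[of j] by (intro mult_right_mono) auto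
  moreover have "10000 \<le> L ^ j" using Lpow_ge[OF assms] by simp
  ultimately have "800 \<le> t" unfolding t_def by linarith
  then have "160000 \<le> 1 + t + t\<^sup>2 / 2"
    using mult_mono[of 800 t 800 t] by (simp add: power2_eq_square)
  also have "\<dots> \<le> exp t" using \<open>800 \<le> t\<close> by (intro exp_lower_Taylor_quadratic) simp
  finally have "4 / n * (1 / exp t) \<le> 4 / n * (1 / 160000)" by (intro mult_left_mono divide_left_mono) auto
  moreover have "exp (- (ln 2 / 2) * L ^ j) * exp (L ^ j / 4) = 1 / exp t"
    by (simp add: t_def exp_add[symmetric] exp_minus[symmetric] inverse_eq_divide[symmetric])
  ultimately show ?thesis by (simp add: mult_ac)
qed

section \<open>Drift of a single layer\<close>

definition X :: "nat \<Rightarrow> (nat \<Rightarrow> real) \<Rightarrow> (nat \<Rightarrow> real) \<Rightarrow> real" where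
  "X j p y = 2 * (\<Sum>i=1..n. p i * jump n (\<phi> j) (y i)) - decay n (\<phi> j) y"

lemma jump_\<phi>_nonneg: "1 \<le> j \<Longrightarrow> 0 \<le> jump n (\<phi> j) x"
  unfolding \<phi>_Suc using rate_ge[of j] height_le[of j] n by (intro jump_ladder) auto

text \<open>In units of b/n, the doubled jumps contribute at most \<Phi> j/20 and
  \<open>decay\<close> removes at least (\<Phi> j - n)/2. The resulting 45/100 is weakened to the
  drift shared with layer 0.\<close>

lemma X_le:
  assumes adm: "admissible p y" and j: "1 \<le> j" "j < k" and good: "\<Phi> (j - 1) y \<le> 7 * n"
  shows "X j p y \<le> b / n * (n / 2 - 15 / 100 * \<Phi> j y)"
proof -
  have p: "p i \<le> 4 / n * exp (- (ln 2 / 2) * L ^ j)" if "i \<in> {1..n}" "height j - 1 < y i" for i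
    using adm j card_above_le[OF j(1) good] that unfolding admissible_def by blast
  have n1: "1 \<le> n" using n by simp
  have pv: "prob_vector n p" using adm by (simp add: admissible_def)
  have "(\<Sum>i=1..n. p i * jump n (\<phi> j) (y i)) \<le> 4 / n * exp (- (ln 2 / 2) * L ^ j) * exp (L ^ j / 4) * \<Phi> j y"
    unfolding \<Phi>_def \<phi>_Suc[OF j(1)]
    using p rate_ge[of j] height_le[of j] n1 by (intro sum_jump_ladder_le pv) auto
  also have "\<dots> \<le> b / (40 * n) * \<Phi> j y" 
    using \<Phi>_pos[of j y] by (intro mult_right_mono exp_decay_le j) auto
  finally have "2 * (\<Sum>i=1..n. p i * jump n (\<phi> j) (y i)) \<le> b / n * (\<Phi> j y / 20)" by simp
  moreover have "b / n / 2 * (\<Phi> j y - n) \<le> decay n (\<phi> j) y"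
    unfolding \<Phi>_def \<phi>_Suc[OF j(1)] using rate_ge[of j] height_le[of j] n1 by (intro decay_ladder) auto
  ultimately have "X j p y \<le> b / n * (\<Phi> j y / 20) - b / n / 2 * (\<Phi> j y - n)"
    by (simp add: X_def)
  also have "\<dots> = b / n * (n / 2 - 45 / 100 * \<Phi> j y)"
    using n by (simp add: field_simps)
  also have "\<dots> \<le> b / n * (n / 2 - 15 / 100 * \<Phi> j y)" using \<Phi>_pos[of j y] by (intro mult_left_mono) auto
  finally show ?thesis .
qed

text \<open>Jumps are nonnegative, so the doubled jump term of \<open>X\<close>, there for the
  exponential moment, also bounds the mean; one estimate serves both branches of
  \<open>damped\<close>.\<close>

lemma mean_\<Phi>_le:
  assumes pv: "prob_vector n p" and j: "1 \<le> j"
  shows "(\<Sum>i=1..n. p i * \<Phi> j (shift n y i)) \<le> \<Phi> j y + X j p y"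
proof -
  have "0 \<le> (\<Sum>i=1..n. p i * jump n (\<phi> j) (y i))"
    using pv j by (intro sum_nonneg mult_nonneg_nonneg jump_\<phi>_nonneg) (auto simp: prob_vector_def)
  then show ?thesis unfolding \<Phi>_def mean_potential_shift[OF pv] X_def by linarith
qed

text \<open>j < k - 1 bounds exp (7 L^(j+1)) by Q, and 500 b = 1/2 bounds the base potential by 2
  n^(1/2) = 2 Q^2. The product 2 Q^3 is still below n = Q^4 by a factor that beats ln n.\<close>

lemma step_small:
  assumes "j < k - 1" "\<bar>x\<bar> \<le> 500 * ln n" shows "10 * ln n / n * (exp (L ^ j) * \<phi> j x) \<le> 1 / 10"
proof -
  have "exp (L ^ j) * \<phi> j x \<le> exp (L ^ j) * (exp (6 * L ^ (j + 1)) * two_sided b x)"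
    by (intro mult_left_mono \<phi>_le_base) auto
  also have "\<dots> = exp (L ^ j + 6 * L ^ (j + 1)) * two_sided b x" by (simp add: exp_add)
  also have "\<dots> \<le> Q * (2 * Q ^ 2)"
  proof (intro mult_mono)
    have "exp (L ^ j + 6 * L ^ (j + 1)) \<le> exp (7 * L ^ (j + 1))" using Lpow_mono[of j "j + 1"] by simp
    also have "\<dots> \<le> Q" using assms by (intro exp_L_le_Q) auto
    finally show "exp (L ^ j + 6 * L ^ (j + 1)) \<le> Q" .
    have "two_sided b x \<le> 2 * exp (b * \<bar>x\<bar>)" by (rule two_sided_le) simp
    also have "\<dots> \<le> 2 * exp (real 2 / 4 * ln n)" using assms by simp
    finally show "two_sided b x \<le> 2 * Q ^ 2" unfolding exp_ln_n .
  qed (use Q in \<open>auto simp: two_sided_def\<close>)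
  finally have "10 * ln n / n * (exp (L ^ j) * \<phi> j x) \<le> 10 * ln n / n * (Q * (2 * Q ^ 2))"
    using ln_n_ge by (intro mult_left_mono) auto
  also have "\<dots> = 20 * ln n / Q" unfolding Q(2)[symmetric] using Q(1) by (simp add: field_simps eval_nat_numeral)
  also have "\<dots> \<le> 1 / 10" using ln_n_le Q(1) ln_n_ge by (simp add: field_simps)
  finally show ?thesis .
qed

lemma exp_mean_\<Phi>_le:
  assumes pv: "prob_vector n p" and j: "1 \<le> j" "j < k - 1" and y: "\<And>i. i \<in> {1..n} \<Longrightarrow> \<bar>y i\<bar> \<le> 500 * ln n"
  shows "(\<Sum>i=1..n. p i * exp (10 * ln n / n * (\<Phi> j (shift n y i) - \<Phi> j y))) \<le> exp (10 * ln n / n * X j p y)"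
  unfolding \<Phi>_def X_def \<phi>_Suc[OF j(1)]
proof (intro ladder_exp_mean pv)
  fix i assume i: "i \<in> {1..n}"
  have "10 * ln n / n * (exp (L ^ j / 4) * \<phi> j (y i)) \<le> 10 * ln n / n * (exp (L ^ j) * \<phi> j (y i))"
    using ln_n_ge rate_ge[of j] \<phi>_pos[of j "y i"] by (intro mult_left_mono mult_right_mono) auto
  also have "\<dots> \<le> 1 / 10" using j y[OF i] by (intro step_small) auto
  finally show "10 * ln n / n * (exp (L ^ j / 4) * ladder b (L ^ j / 4) (height j) (height (j + 1)) (y i)) \<le> 1"
    by (simp add: \<phi>_Suc[OF j(1)])
qed (use rate_ge[of j] height_le[of j] n ln_n_ge in auto)

lemma n_facts: "3 \<le> n" "100 \<le> n" "10 * ln n \<le> n"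
proof -
  show "3 \<le> n" "100 \<le> n" using n_ge by auto
  have "10 * ln n \<le> Q * 1" using ln_n_le ln_n_ge by simp
  also have "\<dots> \<le> Q ^ 1 * Q ^ 3" using Q_ge one_le_power[of Q 3] by (intro mult_mono) auto
  also have "\<dots> = n" using Q(2) by (simp flip: power_add power_Suc)
  finally show "10 * ln n \<le> n" .
qed

text \<open>The additive error of one step. For the undamped last layer it is of the order of the
  contraction rate, so the equilibrium there is a constant.\<close>

definition tiny :: "nat \<Rightarrow> real" where
  "tiny j = (if j < k - 1 then 2 / real n ^ 10 else 1 / n)"

lemma V_drift_good:
  assumes adm: "admissible p y" and j: "1 \<le> j" "j < k" and good: "\<Phi> (j - 1) y \<le> 7 * n"
    and y: "\<And>i. i \<in> {1..n} \<Longrightarrow> \<bar>y i\<bar> \<le> 500 * ln n"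
  shows "(\<Sum>i=1..n. p i * V j (shift n y i)) \<le> (1 - b / (50 * real n)) * V j y + tiny j"
proof -
  have pv: "prob_vector n p" using adm by (simp add: admissible_def)
  show ?thesis
  proof (cases "j < k - 1")
    case True
    have "(\<Sum>i=1..n. p i * damped n (\<Phi> j (shift n y i))) \<le> (1 - b / (50 * real n)) * damped n (\<Phi> j y) + 2 / real n ^ 10"
      using \<Phi>_pos[of j y] pv
      by (intro damped_contraction[OF _ _ n_facts(1,3) _ _ X_le[OF adm j good] mean_\<Phi>_le[OF pv j(1)] 
            exp_mean_\<Phi>_le[OF pv j(1) True y]]) (auto simp: prob_vector_def)
    then show ?thesis using True by (simp add: V_def tiny_def)
  next
    case False
    have "(\<Sum>i=1..n. p i * V j (shift n y i)) = (\<Sum>i=1..n. p i * \<Phi> j (shift n y i)) / n"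
      using False by (simp add: V_def sum_divide_distrib)
    also have "\<dots> \<le> (\<Phi> j y + b / n * (n / 2 - 15 / 100 * \<Phi> j y)) / n"
      using mean_\<Phi>_le[OF pv j(1), of y] X_le[OF adm j good] by (intro divide_right_mono) auto
    also have "\<dots> = (1 - b * (15 / 100) / n) * (\<Phi> j y / n) + b / 2 / n"
      using n by (simp add: field_simps)
    also have "\<dots> \<le> (1 - b / (50 * real n)) * (\<Phi> j y / n) + 1 / n"
      using \<Phi>_pos[of j y] n by (intro add_mono mult_right_mono) (auto simp: field_simps)
    finally show ?thesis using False by (simp add: V_def tiny_def)
  qed
qed

text \<open>Here V (j - 1) equals \<Phi> (j - 1)/n \<ge> 7 and dominates \<Phi> j/n up to exp (6
  L^(j+1)). The linear branch grows by at most O(exp (L^j)/n) times that. On the exponential branch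
  \<Phi> j is still below 7 n, so the exponent grows by O(exp (L^j) ln n / n).\<close>

lemma V_drift_bad:
  assumes adm: "admissible p y" and j: "1 \<le> j" "j < k" and bad: "7 * n < \<Phi> (j - 1) y"
    and y: "\<And>i. i \<in> {1..n} \<Longrightarrow> \<bar>y i\<bar> \<le> 500 * ln n"
  shows "(\<Sum>i=1..n. p i * V j (shift n y i)) \<le> 
     (1 - b / (50 * real n)) * V j y + 4000 * ln n * exp (L ^ j + 6 * L ^ (j + 1)) / n * V (j - 1) y"
proof -
  have pv: "prob_vector n p" using adm by (simp add: admissible_def)
  have n1: "1 \<le> n" using n by simp
  define E where "E = exp (6 * L ^ (j + 1))"
  define G where "G = exp (L ^ j)"
  define U where "U = V (j - 1) y"
  have G1: "1 \<le> G" and E1: "1 \<le> E" using L by (auto simp: G_def E_def)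
  have lnn: "1 \<le> ln n" using ln_n_ge by simp
  have U: "U = \<Phi> (j - 1) y / n" using j bad n_facts(1) by (simp add: U_def V_def damped_eq)
  have U7: "7 \<le> U" using bad n unfolding U by (simp add: pos_le_divide_eq)
  have \<Phi>U: "\<Phi> j y / n \<le> E * U"
    using \<Phi>_le_previous[OF j(1), of y] n unfolding U E_def by (simp add: divide_right_mono)
  have sJ: "(\<Sum>i=1..n. p i * jump n (\<phi> j) (y i)) \<le> 2 * G * (\<Phi> j y / n)"
  proof -
    have "(\<Sum>i=1..n. p i * jump n (\<phi> j) (y i)) \<le> 2 / n * exp (L ^ j / 4) * \<Phi> j y"
      unfolding \<Phi>_def \<phi>_Suc[OF j(1)]
      using adm rate_ge[of j] height_le[of j] n1 by (intro sum_jump_ladder_le pv) (auto simp: admissible_def)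
    also have "\<dots> \<le> 2 / n * G * \<Phi> j y" 
      unfolding G_def using rate_ge[of j] \<Phi>_pos[of j y] by (intro mult_right_mono mult_left_mono) auto
    finally show ?thesis by simp
  qed
  have dec: "0 \<le> decay n (\<phi> j) y"
    unfolding \<phi>_Suc[OF j(1)] using rate_ge[of j] height_le[of j] n1 by (intro decay_ladder(2)) auto
  \<comment> \<open>8 of the 4000 units are kept back, to pay for the contraction term that is
    inserted at the end.\<close>
  have main: "(\<Sum>i=1..n. p i * V j (shift n y i)) \<le> V j y + 3992 * ln n * G * E / n * U"
  proof (cases "V j y = \<Phi> j y / n")
    case True
    have "(\<Sum>i=1..n. p i * V j (shift n y i)) \<le> (\<Sum>i=1..n. p i * (\<Phi> j (shift n y i) / n))"
      using pv by (intro sum_mono mult_left_mono V_le) (auto simp: prob_vector_def)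
    also have "\<dots> = (\<Sum>i=1..n. p i * \<Phi> j (shift n y i)) / n" by (simp add: sum_divide_distrib)
    also have "\<dots> \<le> (\<Phi> j y + 2 * G * (\<Phi> j y / n)) / n"
      unfolding \<Phi>_def mean_potential_shift[OF pv] using sJ dec by (intro divide_right_mono) (auto simp: \<Phi>_def)
    also have "\<dots> = V j y + 2 * G / n * (\<Phi> j y / n)" by (simp add: True add_divide_distrib)
    also have "2 * G / n * (\<Phi> j y / n) \<le> 2 * G / n * (E * U)" using \<Phi>U G1 by (intro mult_left_mono) auto
    also have "\<dots> = 2 * (G * E * U / n)" by simp
    also have "\<dots> \<le> (3992 * ln n) * (G * E * U / n)" using lnn G1 E1 U7 by (intro mult_right_mono) auto
    finally show ?thesis by simp
  next
    case False
    then have jk: "j < k - 1" by (auto simp: V_def split: if_splits)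
    have Vd: "V j y = damped n (\<Phi> j y)" using jk by (simp add: V_def)
    have \<Phi>7: "\<Phi> j y < 7 * n" using False Vd damped_eq[OF n_facts(1), of "\<Phi> j y"] by linarith
    define \<theta> where "\<theta> = 10 * ln n / n"
    have \<theta>: "0 \<le> \<theta>" using lnn by (simp add: \<theta>_def)
    define f where "f = exp (\<theta> * (\<Phi> j y - 6 * real n))"
    have Vf: "V j y = f" using False unfolding Vd damped_def f_def \<theta>_def by (auto simp: min_def split: if_splits)
    have "\<Phi> j y / n \<le> 7" using \<Phi>7 n by (simp add: pos_divide_le_eq)
    then have f7: "f \<le> 7" using Vf V_le[of j y] by linarith
    \<comment> \<open>28 = 2 * 2 * 7: the doubling in \<open>X\<close>, the bound 2/n on the
      probabilities and \<Phi> j < 7 n.\<close>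
    have small: "28 * \<theta> * G \<le> 1"
    proof -
      have "G \<le> Q" unfolding G_def using exp_L_le_Q[of j 1] j by simp
      then have "28 * \<theta> * G \<le> 28 * \<theta> * Q" using \<theta> by (intro mult_left_mono) auto
      also have "\<dots> = 280 * ln n / Q ^ 3" unfolding \<theta>_def Q(2)[symmetric] using Q(1) by (simp add: field_simps eval_nat_numeral)
      also have "\<dots> \<le> 1"
      proof -
        have "280 * ln n \<le> Q ^ 1" using ln_n_le ln_n_ge by simp
        also have "\<dots> \<le> Q ^ 3" using Q_ge by (intro power_increasing) auto
        finally show ?thesis using Q by simp
      qed
      finally show ?thesis .
    qed
    have "(\<Sum>i=1..n. p i * V j (shift n y i)) = (\<Sum>i=1..n. p i * damped n (\<Phi> j (shift n y i)))"
      using jk by (simp add: V_def)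
    also have "\<dots> \<le> f * (\<Sum>i=1..n. p i * exp (\<theta> * (\<Phi> j (shift n y i) - \<Phi> j y)))"
      unfolding f_def \<theta>_def using pv by (intro sum_damped_le(2)) (auto simp: prob_vector_def)
    also have "\<dots> \<le> f * exp (\<theta> * X j p y)"
      unfolding \<theta>_def by (intro mult_left_mono exp_mean_\<Phi>_le pv j jk y) (auto simp: f_def)
    also have "\<dots> \<le> f * exp (28 * \<theta> * G)"
    proof -
      have "X j p y \<le> 2 * (2 * G * (\<Phi> j y / n))" using sJ dec by (simp add: X_def)
      also have "\<dots> \<le> 2 * (2 * G * 7)" using \<Phi>7 n G1 by (intro mult_left_mono) (auto simp: field_simps)
      finally have "\<theta> * X j p y \<le> \<theta> * (28 * G)" using \<theta> by (intro mult_left_mono) auto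
      then show ?thesis by (simp add: f_def mult_ac)
    qed
    also have "\<dots> \<le> f * (1 + 2 * (28 * \<theta> * G))"
    proof -
      have "0 \<le> 28 * \<theta> * G" using \<theta> G1 by simp
      then have "(28 * \<theta> * G)\<^sup>2 \<le> 28 * \<theta> * G" using small by (simp only: power2_eq_square mult_left_le)
      then show ?thesis using exp_le_quadratic[OF small] by (intro mult_left_mono) (auto simp: f_def)
    qed
    also have "\<dots> = f + f * (56 * \<theta> * G)" by (simp add: algebra_simps)
    also have "f * (56 * \<theta> * G) \<le> 7 * (56 * \<theta> * G)" using f7 \<theta> G1 by (intro mult_right_mono) auto
    also have "7 * (56 * \<theta> * G) = (3920 * ln n * G / n) * 1" by (simp add: \<theta>_def)
    also have "\<dots> \<le> (3992 * ln n * G / n) * (E * U)"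
    proof (intro mult_mono)
      show "1 \<le> E * U" using mult_mono[of 1 E 1 U] E1 U7 by simp
      show "3920 * ln n * G / n \<le> 3992 * ln n * G / n" using lnn G1 by (intro divide_right_mono mult_right_mono) auto
    qed (use lnn G1 in auto)
    finally show ?thesis by (simp add: Vf)
  qed
  have "b / (50 * real n) * V j y \<le> b / (50 * real n) * (E * U)"
    using V_le[of j y] \<Phi>U by (intro mult_left_mono) auto
  also have "\<dots> \<le> (8 * ln n * G / n) * (E * U)"
  proof (intro mult_right_mono)
    have "b / 50 \<le> 8 * (1 * 1)" by simp
    also have "\<dots> \<le> 8 * (ln n * G)" using lnn G1 by (intro mult_left_mono mult_mono) auto
    finally have "b / 50 / n \<le> 8 * (ln n * G) / n" by (intro divide_right_mono) auto
    then show "b / (50 * real n) \<le> 8 * ln n * G / n" by simp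
  qed (use E1 U7 in auto)
  finally have "b / (50 * real n) * V j y \<le> 8 * ln n * G * E / n * U" by simp
  moreover have "4000 * ln n * exp (L ^ j + 6 * L ^ (j + 1)) / n * V (j - 1) y = 
      3992 * ln n * G * E / n * U + 8 * ln n * G * E / n * U"
    by (simp add: exp_add G_def E_def U_def field_simps)
  moreover have "(1 - b / (50 * real n)) * V j y = V j y - b / (50 * real n) * V j y"
    by (simp add: left_diff_distrib)
  ultimately show ?thesis using main by linarith
qed

text \<open>Layer 0 has no predecessor: its contraction rests on \<open>top_half\<close> and holds
  in every state without far loads.\<close>

lemma V_drift_0:
  assumes adm: "admissible p y" and y: "\<And>i. i \<in> {1..n} \<Longrightarrow> \<bar>y i\<bar> \<le> 500 * ln n"
  shows "(\<Sum>i=1..n. p i * V 0 (shift n y i)) \<le> (1 - b / (50 * real n)) * V 0 y + tiny 0"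
proof -
  have pv: "prob_vector n p" and p2: "\<And>i. i \<in> {1..n} \<Longrightarrow> p i \<le> 2 / n" and zero: "(\<Sum>i=1..n. y i) = 0"
    using adm by (auto simp: admissible_def)
  obtain T i0 where th: "top_half n p y T i0" using adm by (auto simp: admissible_def)
  have k0: "0 < k - 1" using k by simp
  have \<Phi>0: "\<Phi> 0 = potential n (two_sided b)" by (simp add: \<Phi>_def \<phi>_def fun_eq_iff)
  let ?X = "b / n * (n / 2 - 15 / 100 * \<Phi> 0 y)"
  have mean: "(\<Sum>i=1..n. p i * \<Phi> 0 (shift n y i)) \<le> \<Phi> 0 y + ?X"
  proof -
    have "(\<Sum>i=1..n. p i * jump n (two_sided b) (y i)) - decay n (two_sided b) y
       \<le> b / n * (48 / 100 * n - 18 / 100 * \<Phi> 0 y)"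
      unfolding \<Phi>0 by (intro two_sided_mean_drift[OF pv th n_facts(2) p2 zero]) auto
    also have "\<dots> \<le> ?X" using \<Phi>_pos[of 0 y] by (intro mult_left_mono) auto
    finally show ?thesis unfolding \<Phi>0 mean_potential_shift[OF pv] by simp
  qed
  have emean: "(\<Sum>i=1..n. p i * exp (10 * ln n / n * (\<Phi> 0 (shift n y i) - \<Phi> 0 y))) \<le> exp (10 * ln n / n * ?X)"
    unfolding \<Phi>0
  proof (intro two_sided_exp_drift[OF pv th n_facts(2) p2 zero])
    fix i assume "i \<in> {1..n}"
    then have "10 * ln n / n * (exp (L ^ 0) * \<phi> 0 (y i)) \<le> 1 / 10" using y k0 by (intro step_small) auto
    moreover have "10 * ln n / n * (1 * \<phi> 0 (y i)) \<le> 10 * ln n / n * (exp (L ^ 0) * \<phi> 0 (y i))"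
      using ln_n_ge \<phi>_pos[of 0 "y i"] by (intro mult_left_mono mult_right_mono) auto
    ultimately show "10 * ln n / n * two_sided b (y i) \<le> 1 / 10" by (simp add: \<phi>_def)
  qed (use ln_n_ge in auto)
  have "(\<Sum>i=1..n. p i * damped n (\<Phi> 0 (shift n y i))) \<le> (1 - b / (50 * real n)) * damped n (\<Phi> 0 y) + 2 / real n ^ 10"
    using \<Phi>_pos[of 0 y] pv
    by (intro damped_contraction[OF _ _ n_facts(1,3) _ _ _ mean emean]) (auto simp: prob_vector_def)
  then show ?thesis using k0 by (simp add: V_def tiny_def)
qed

section \<open>Drift of the weighted sum\<close>

definition S :: "(nat \<Rightarrow> real) \<Rightarrow> real" where
  "S y = (\<Sum>j<k. w j * V j y)"

text \<open>This is n^(-1/4); the remaining estimates compare its powers, where one step in the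
  exponent is worth at least a factor of 1000.\<close>

definition z :: real where "z = 1 / Q"

lemma z_pos: "0 < z" using Q by (simp add: z_def)

lemma z_le: "z \<le> 1 / 10 ^ 16" unfolding z_def using Q_ge by (intro divide_left_mono) auto

lemma z_pow: "1 / Q ^ m = z ^ m" by (simp add: z_def power_one_over)

lemma z_mono: "l \<le> m \<Longrightarrow> z ^ m \<le> z ^ l"
  using z_pos z_le by (intro power_decreasing) auto

lemma z_less: "l < m \<Longrightarrow> 1000 * z ^ m \<le> z ^ l"
proof -
  assume "l < m"
  then have "z ^ m \<le> z ^ Suc l" by (intro z_mono) simp
  also have "\<dots> = z * z ^ l" by simp
  also have "\<dots> \<le> 1 / 1000 * z ^ l" using z_le z_pos by (intro mult_right_mono) auto
  finally show ?thesis by simp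
qed

lemma inverse_n: "1 / real n = z ^ 4" unfolding Q(2)[symmetric] z_pow ..

lemma w_last_le: "w (k - 1) \<le> z ^ 27" "z ^ 28 \<le> w (k - 1)"
proof -
  have kk: "L ^ (k - 1 + 1) = ln n" using k by (simp add: ln_n)
  have "w (k - 1) = exp (14 * L ^ (k - 1)) * exp (- (real 28 / 4 * ln n))"
    unfolding w_def kk by (simp flip: exp_add)
  then have w: "w (k - 1) = exp (14 * L ^ (k - 1)) * z ^ 28"
    unfolding exp_minus exp_ln_n by (simp add: z_def power_one_over field_simps)
  have "exp (14 * L ^ (k - 1)) * z ^ 28 \<le> Q * z ^ 28" using z_pos by (intro mult_right_mono exp_L_le_Q) auto
  also have "\<dots> = (Q * z) * z ^ 27" by (simp flip: power_Suc)
  also have "\<dots> = z ^ 27" using Q by (simp add: z_def)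
  finally show "w (k - 1) \<le> z ^ 27" using w by simp
  have "1 \<le> exp (14 * L ^ (k - 1))" using L by simp
  then have "1 * z ^ 28 \<le> exp (14 * L ^ (k - 1)) * z ^ 28" using z_pos by (intro mult_right_mono) auto
  then show "z ^ 28 \<le> w (k - 1)" using w by simp
qed

lemma sum_lessThan_split: "(\<Sum>j<k. g j) = (\<Sum>j<k - 1. g j) + g (k - 1)" for g :: "nat \<Rightarrow> real"
  using sum.lessThan_Suc[of g "k - 1"] k by simp

text \<open>The damped layers have total weight at most Q and error 2 n^(-10), together 2 z^39; the
  last layer has weight at most z^27 and error z^4.\<close>

lemma sum_tiny: "(\<Sum>j<k. w j * tiny j) \<le> z ^ 30"
proof -
  have "(\<Sum>j<k. w j * tiny j) = (\<Sum>j<k - 1. w j * (2 / real n ^ 10)) + w (k - 1) * (1 / n)"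
    unfolding sum_lessThan_split by (simp add: tiny_def)
  also have "(\<Sum>j<k - 1. w j * (2 / real n ^ 10)) = (\<Sum>j<k - 1. w j) * (2 * z ^ 40)"
  proof -
    have "2 / real n ^ 10 = 2 * (1 / real n) ^ 10" by (simp add: power_one_over)
    also have "\<dots> = 2 * z ^ 40" unfolding inverse_n by (simp flip: power_mult)
    finally show ?thesis by (simp add: sum_distrib_right)
  qed
  also have "\<dots> \<le> Q * (2 * z ^ 40)"
  proof (intro mult_right_mono)
    have "(\<Sum>j<k - 1. w j) \<le> (\<Sum>j<k. w j)" using w_pos by (intro sum_mono2) (auto intro: less_imp_le)
    then show "(\<Sum>j<k - 1. w j) \<le> Q" using sum_w_le by simp
  qed (use z_pos in simp)
  also have "Q * (2 * z ^ 40) = 2 * (Q * z) * z ^ 39" by (simp flip: power_Suc)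
  also have "\<dots> = 2 * z ^ 39" using Q by (simp add: z_def)
  also have "w (k - 1) * (1 / n) \<le> z ^ 27 * z ^ 4"
    unfolding inverse_n using w_last_le z_pos by (intro mult_right_mono) auto
  also have "z ^ 27 * z ^ 4 = z ^ 31" by (simp flip: power_add)
  finally have "(\<Sum>j<k. w j * tiny j) \<le> 2 * z ^ 39 + z ^ 31" by simp
  moreover have "0 < z ^ 30" using z_pos by simp
  ultimately show ?thesis using z_less[of 30 31] z_less[of 30 39] by linarith
qed

lemma S_nonneg: "0 \<le> S y"
  unfolding S_def using w_pos V_nonneg by (intro sum_nonneg mult_nonneg_nonneg) (auto intro: less_imp_le)

lemma mean_S: "(\<Sum>i=1..n. p i * S (shift n y i)) = (\<Sum>j<k. w j * (\<Sum>i=1..n. p i * V j (shift n y i)))"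
  unfolding S_def sum_distrib_left
  by (subst sum.swap) (simp add: mult_ac)

text \<open>The loss of layer j is charged to layer j - 1: 4000 against 4 * 10^8 in
  \<open>w_previous\<close> leaves 10^(-5)/n = b/(100 n), half of the available rate b/(50
  n).\<close>

lemma S_drift_good:
  assumes adm: "admissible p y" and y: "\<And>i. i \<in> {1..n} \<Longrightarrow> \<bar>y i\<bar> \<le> 500 * ln n"
  shows "(\<Sum>i=1..n. p i * S (shift n y i)) \<le> (1 - b / (100 * real n)) * S y + z ^ 30"
proof -
  define c where "c j = 4000 * ln n * exp (L ^ j + 6 * L ^ (j + 1)) / n * V (j - 1) y" for j
  have c0: "0 \<le> c j" for j using ln_n_ge V_nonneg by (simp add: c_def)
  have step: "(\<Sum>i=1..n. p i * V j (shift n y i)) \<le> (1 - b / (50 * real n)) * V j y + (if j = 0 then 0 else c j) + tiny j"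
    if "j < k" for j
  proof (cases "j = 0")
    case True then show ?thesis using V_drift_0[OF adm y] by simp
  next
    case False
    then have j: "1 \<le> j" by simp
    have t: "0 \<le> tiny j" by (simp add: tiny_def)
    show ?thesis
    proof (cases "\<Phi> (j - 1) y \<le> 7 * n")
      case True
      then show ?thesis using V_drift_good[OF adm j that True y] c0[of j] False by simp
    next
      case bad: False
      then have "7 * real n < \<Phi> (j - 1) y" by simp
      then show ?thesis using V_drift_bad[OF adm j that _ y] t False by (simp add: c_def)
    qed
  qed
  have "(\<Sum>i=1..n. p i * S (shift n y i)) \<le> 
      (\<Sum>j<k. w j * ((1 - b / (50 * real n)) * V j y + (if j = 0 then 0 else c j) + tiny j))"
    unfolding mean_S using w_pos by (intro sum_mono mult_left_mono step) (auto intro: less_imp_le)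
  also have "\<dots> = (1 - b / (50 * real n)) * S y + (\<Sum>j<k. w j * (if j = 0 then 0 else c j)) + (\<Sum>j<k. w j * tiny j)"
    unfolding S_def sum_distrib_left sum.distrib[symmetric] by (rule sum.cong) (auto simp: algebra_simps)
  also have "(\<Sum>j<k. w j * (if j = 0 then 0 else c j)) \<le> b / (100 * real n) * S y"
  proof -
    obtain k' where k': "k = Suc k'" using k by (cases k) auto
    have "(\<Sum>j<k. w j * (if j = 0 then 0 else c j)) = (\<Sum>j<k'. w (Suc j) * c (Suc j))"
      unfolding k' sum.lessThan_Suc_shift by simp
    also have "\<dots> \<le> (\<Sum>j<k'. b / (100 * real n) * (w j * V j y))"
    proof (intro sum_mono)
      fix j assume "j \<in> {..<k'}"
      then have "4 * 10 ^ 8 * ln n * exp (L ^ Suc j + 6 * L ^ (Suc j + 1)) * w (Suc j) \<le> w j"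
        using w_previous[of "Suc j"] k' by simp
      then have "(4 * 10 ^ 8 * ln n * exp (L ^ Suc j + 6 * L ^ (Suc j + 1)) * w (Suc j)) * (1 / (100000 * n) * V j y)
         \<le> w j * (1 / (100000 * n) * V j y)"
        using V_nonneg by (intro mult_right_mono) auto
      then show "w (Suc j) * c (Suc j) \<le> b / (100 * real n) * (w j * V j y)"
        by (simp add: c_def mult_ac)
    qed
    also have "\<dots> = b / (100 * real n) * (\<Sum>j<k'. w j * V j y)" by (simp add: sum_distrib_left)
    also have "\<dots> \<le> b / (100 * real n) * S y"
      unfolding S_def using w_pos V_nonneg k'
      by (intro mult_left_mono sum_mono2 mult_nonneg_nonneg) (auto intro: less_imp_le)
    finally show ?thesis .
  qed
  also have "(\<Sum>j<k. w j * tiny j) \<le> z ^ 30" by (rule sum_tiny)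
  finally have "(\<Sum>i=1..n. p i * S (shift n y i)) \<le> (1 - b / (50 * real n)) * S y + b / (100 * real n) * S y + z ^ 30" by simp
  also have "\<dots> = (1 - b / (100 * real n)) * S y + z ^ 30" using n by (simp add: field_simps)
  finally show ?thesis .
qed

abbreviation G :: "(nat \<Rightarrow> real) \<Rightarrow> real" where
  "G \<equiv> potential n (two_sided a)"

lemma G_nonneg: "0 \<le> G y"
  by (simp add: potential_def two_sided_def sum_nonneg)

text \<open>No drift is used here. The extreme load \<open>Y\<close> bounds \<open>S\<close> after
  the step by 2 Q exp (b Y), whereas \<open>G\<close> is at least exp (a Y), larger by exp ((a - b)
  Y) \<ge> Q^38.\<close>

lemma S_drift_far:
  assumes adm: "admissible p y" and i0: "i0 \<in> {1..n}" "500 * ln n < \<bar>y i0\<bar>"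
  shows "(\<Sum>i=1..n. p i * S (shift n y i)) \<le> 2 * z ^ 37 * G y"
proof -
  define Y where "Y = Max ((\<lambda>i. \<bar>y i\<bar>) ` {1..n})"
  have Yle: "\<bar>y i\<bar> \<le> Y" if "i \<in> {1..n}" for i unfolding Y_def using that by (intro Max_ge) auto
  have "Y \<in> (\<lambda>i. \<bar>y i\<bar>) ` {1..n}" unfolding Y_def using i0 by (intro Max_in) auto
  then obtain i1 where i1: "i1 \<in> {1..n}" "\<bar>y i1\<bar> = Y" by auto
  have Y: "500 * ln n \<le> Y" using Yle[OF i0(1)] i0(2) by simp
  have "S (shift n y i) \<le> 2 * Q * exp (b * Y)" if i: "i \<in> {1..n}" for i
  proof -
    have "S (shift n y i) \<le> (\<Sum>j<k. w j * (exp (7 * L ^ (j + 1)) * (2 * exp (b * Y))))"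
      unfolding S_def
    proof (intro sum_mono mult_left_mono)
      fix j
      have "V j (shift n y i) \<le> \<Phi> j (shift n y i) / n" by (rule V_le)
      also have "\<dots> \<le> exp (7 * L ^ (j + 1)) * (2 * exp (b * Y))"
        using \<Phi>_shift_le[OF Yle i, where j = j] n by (simp add: pos_divide_le_eq mult_ac)
      finally show "V j (shift n y i) \<le> exp (7 * L ^ (j + 1)) * (2 * exp (b * Y))" .
    qed (auto intro: less_imp_le w_pos)
    also have "\<dots> = (\<Sum>j<k. w j * exp (7 * L ^ (j + 1))) * (2 * exp (b * Y))"
      unfolding sum_distrib_right by (rule sum.cong) auto
    also have "\<dots> \<le> Q * (2 * exp (b * Y))" by (intro mult_right_mono sum_w_le) auto
    finally show ?thesis by simp
  qed
  then have "(\<Sum>i=1..n. p i * S (shift n y i)) \<le> (\<Sum>i=1..n. p i * (2 * Q * exp (b * Y)))"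
    using adm by (intro sum_mono mult_left_mono) (auto simp: admissible_def prob_vector_def)
  also have "\<dots> = 2 * Q * exp (b * Y)"
    using adm by (simp add: admissible_def prob_vector_def flip: sum_distrib_right)
  also have "\<dots> \<le> 2 * Q * (z ^ 38 * G y)"
  proof (intro mult_left_mono)
    have "exp (b * Y) = exp (- ((a - b) * Y)) * exp (a * Y)" by (simp flip: exp_add)
    also have "exp (- ((a - b) * Y)) \<le> exp (- (real 38 / 4 * ln n))" using Y by simp
    also have "\<dots> = z ^ 38" unfolding exp_minus exp_ln_n by (simp add: z_def power_one_over field_simps)
    also have "exp (a * Y) \<le> G y"
    proof -
      have "exp (a * Y) \<le> two_sided a (y i1)"
        unfolding i1(2)[symmetric] by (auto simp: two_sided_eq abs_if)
      also have "\<dots> \<le> G y" unfolding potential_def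
        using i1 by (intro member_le_sum) (auto simp: two_sided_def)
      finally show ?thesis .
    qed
    finally show "exp (b * Y) \<le> z ^ 38 * G y" using z_pos by simp
  qed (use Q in auto)
  also have "\<dots> = 2 * (Q * z) * z ^ 37 * G y" by (simp flip: power_Suc)
  also have "\<dots> = 2 * z ^ 37 * G y" using Q by (simp add: z_def)
  finally show ?thesis .
qed

lemma W_eq: "W y = S y + z ^ 28 * G y"
  by (simp add: W_def S_def z_pow[symmetric])

lemma W_nonneg: "0 \<le> W y"
  using S_nonneg[of y] G_nonneg[of y] z_pos by (simp add: W_eq)

lemma rate: "b / (100 * real n) = z ^ 4 / 100000" "z ^ 4 / 100000 \<le> 1"
  using inverse_n z_mono[of 0 4] by simp_all

text \<open>Far states cost 2 z^37 G, while z^28 G itself decays by a constant times z^32 G; this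
  pays for the far states and for the common rate z^4/100000.\<close>

lemma W_drift:
  assumes adm: "admissible p y"
  shows "(\<Sum>i=1..n. p i * W (shift n y i)) \<le> (1 - z ^ 4 / 100000) * W y + z ^ 28"
proof -
  have pv: "prob_vector n p" and p2: "\<And>i. i \<in> {1..n} \<Longrightarrow> p i \<le> 2 / n" and zero: "(\<Sum>i=1..n. y i) = 0"
    using adm by (auto simp: admissible_def)
  obtain T i0 where th: "top_half n p y T i0" using adm by (auto simp: admissible_def)
  have Sd: "(\<Sum>i=1..n. p i * S (shift n y i)) \<le> (1 - z ^ 4 / 100000) * S y + z ^ 30 + 2 * z ^ 37 * G y"
  proof (cases "\<forall>i\<in>{1..n}. \<bar>y i\<bar> \<le> 500 * ln n")
    case True
    have "0 \<le> 2 * z ^ 37 * G y" using z_pos G_nonneg by simp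
    then show ?thesis using S_drift_good[OF adm] True unfolding rate by fastforce
  next
    case False
    have "0 \<le> (1 - z ^ 4 / 100000) * S y + z ^ 30" using rate(2) S_nonneg[of y] z_pos by simp
    then show ?thesis using S_drift_far[OF adm] False by fastforce
  qed
  have Gd: "(\<Sum>i=1..n. p i * G (shift n y i)) \<le> G y + a * (48 / 100 - 18 / 100 * (z ^ 4 * G y))"
  proof -
    have "(\<Sum>i=1..n. p i * jump n (two_sided a) (y i)) - decay n (two_sided a) y
       \<le> a / n * (48 / 100 * n - 18 / 100 * G y)"
      by (intro two_sided_mean_drift[OF pv th n_facts(2) p2 zero]) auto
    also have "\<dots> = a * (48 / 100 - 18 / 100 * (1 / n * G y))" using n by (simp add: field_simps)
    finally show ?thesis unfolding mean_potential_shift[OF pv] inverse_n by simp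
  qed
  have "z ^ 28 * (\<Sum>i=1..n. p i * G (shift n y i)) \<le> z ^ 28 * (G y + a * (48 / 100 - 18 / 100 * (z ^ 4 * G y)))"
    using Gd z_pos by (intro mult_left_mono) auto
  also have "\<dots> = z ^ 28 * G y + 96 / 10000 * z ^ 28 - 36 / 10000 * (z ^ 32 * G y)"
    by (simp add: algebra_simps flip: power_add)
  finally have "(\<Sum>i=1..n. p i * W (shift n y i)) \<le> (1 - z ^ 4 / 100000) * S y + z ^ 30 + 2 * (z ^ 37 * G y)
    + (z ^ 28 * G y + 96 / 10000 * z ^ 28 - 36 / 10000 * (z ^ 32 * G y))"
    using Sd by (simp add: W_eq distrib_left sum.distrib sum_distrib_left mult_ac)
  moreover have "(1 - z ^ 4 / 100000) * W y = (1 - z ^ 4 / 100000) * S y + z ^ 28 * G y - 1 / 100000 * (z ^ 32 * G y)"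
    unfolding W_eq by (simp add: algebra_simps flip: power_add)
  moreover have "1000 * (z ^ 37 * G y) \<le> z ^ 32 * G y"
    using mult_right_mono[OF z_less[of 32 37] G_nonneg[of y]] by (simp add: mult_ac)
  moreover have "1000 * z ^ 30 \<le> z ^ 28" by (rule z_less) simp
  moreover have "0 \<le> z ^ 32 * G y" "0 < z ^ 28" using z_pos G_nonneg[of y] by auto
  ultimately show ?thesis by linarith
qed

text \<open>\<Phi> j \<le> 2 n lies 4 n below the reference point 6 n, so every damped layer starts
  at n^(-40) or less. The dominant contribution is the far potential, 2 n * n^(-7) = 2 z^24.\<close>

lemma W_start: "W (\<lambda>_. 0) \<le> z ^ 22"
proof -
  have \<phi>0: "\<phi> j 0 \<le> 2" for j
  proof (cases "j = 0")
    case False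
    then have "0 \<le> height j" using L by (simp add: height_def)
    then show ?thesis using False ladder_eq_1[OF height_le] by (simp add: \<phi>_def)
  qed (simp add: \<phi>_def two_sided_def)
  have \<Phi>0: "\<Phi> j (\<lambda>_. 0) \<le> 2 * real n" for j
  proof -
    have "\<Phi> j (\<lambda>_. 0) \<le> (\<Sum>i=1..n. 2)" unfolding \<Phi>_def potential_def by (intro sum_mono \<phi>0)
    then show ?thesis by simp
  qed
  have V0: "V j (\<lambda>_. 0) \<le> z ^ 160" if "j < k - 1" for j
  proof -
    have "V j (\<lambda>_. 0) \<le> exp (10 * ln n / n * (\<Phi> j (\<lambda>_. 0) - 6 * real n))" using that by (simp add: V_def damped_def)
    also have "\<dots> \<le> exp (10 * ln n / n * (- 4 * real n))"
      unfolding exp_le_cancel_iff using ln_n_ge \<Phi>0[of j] by (intro mult_left_mono) auto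
    also have "\<dots> = exp (- (real 160 / 4 * ln n))" using n by simp
    also have "\<dots> = z ^ 160" unfolding exp_minus exp_ln_n by (simp add: z_def power_one_over field_simps)
    finally show ?thesis .
  qed
  have "S (\<lambda>_. 0) \<le> (\<Sum>j<k - 1. w j * z ^ 160) + z ^ 27 * 2"
    unfolding S_def sum_lessThan_split
  proof (intro add_mono sum_mono mult_left_mono V0 mult_mono w_last_le)
    have "\<Phi> (k - 1) (\<lambda>_. 0) / n \<le> 2" using \<Phi>0[of "k - 1"] n by (simp add: pos_divide_le_eq)
    then show "V (k - 1) (\<lambda>_. 0) \<le> 2" using V_le[of "k - 1" "\<lambda>_. 0"] by linarith
  qed (use z_pos V_nonneg w_pos in \<open>auto intro: less_imp_le\<close>)
  also have "(\<Sum>j<k - 1. w j * z ^ 160) \<le> Q * z ^ 160"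
  proof -
    have "(\<Sum>j<k - 1. w j) \<le> (\<Sum>j<k. w j)" using w_pos by (intro sum_mono2) (auto intro: less_imp_le)
    then have "(\<Sum>j<k - 1. w j) \<le> Q" using sum_w_le by simp
    then show ?thesis using z_pos by (simp add: mult_right_mono flip: sum_distrib_right)
  qed
  also have "Q * z ^ 160 = (Q * z) * z ^ 159" by (simp flip: power_Suc)
  also have "\<dots> = z ^ 159" using Q by (simp add: z_def)
  finally have "S (\<lambda>_. 0) \<le> z ^ 159 + 2 * z ^ 27" by simp
  moreover have "z ^ 28 * G (\<lambda>_. 0) = 2 * z ^ 24"
  proof -
    have "z ^ 28 * G (\<lambda>_. 0) = 2 * z ^ 24 * (z ^ 4 * real n)"
      by (simp add: potential_def two_sided_def flip: power_add)
    then show ?thesis using n by (simp flip: inverse_n)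
  qed
  ultimately have "W (\<lambda>_. 0) \<le> z ^ 159 + 2 * z ^ 27 + 2 * z ^ 24" by (simp add: W_eq)
  moreover have "0 < z ^ 22" using z_pos by simp
  ultimately show ?thesis using z_less[of 22 159] z_less[of 22 27] z_less[of 22 24] by linarith
qed

text \<open>1000 k L lies above the last ladder, whose full climb gives a single bin the potential
  exp (6 ln n) = n^6. Divided by n and weighted by at least n^(-7), this leaves n^(-2).\<close>

lemma W_large:
  assumes i: "i \<in> {1..n}" "1000 * real k * L < y i" shows "z ^ 8 \<le> W y"
proof -
  have k1: "1 \<le> k - 1" "k - 1 + 1 = k" using k by auto
  have "24 * L * (real k - 1) \<le> 1000 * L * (real k - 1)" using L k by (intro mult_right_mono) auto
  then have "height k \<le> 1000 * real k * L" by (simp add: height_def algebra_simps)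
  then have yk: "height k \<le> y i" using i by simp
  have "L ^ (k - 1) / 4 * (24 * L) = 6 * L ^ (k - 1 + 1)" by simp
  also have "\<dots> = real 24 / 4 * ln n" unfolding k1 ln_n by simp
  finally have "exp (real 24 / 4 * ln n) \<le> \<phi> (k - 1) (y i)"
    unfolding \<phi>_Suc[OF k1(1)] ladder_def k1(2) using yk height_diff[of "k - 1"] k1 L by simp
  then have "Q ^ 24 \<le> \<phi> (k - 1) (y i)" unfolding exp_ln_n .
  also have "\<dots> \<le> \<Phi> (k - 1) y" unfolding \<Phi>_def potential_def using i 
    by (intro member_le_sum) (auto intro: less_imp_le \<phi>_pos)
  finally have "Q ^ 24 * (1 / real n) \<le> \<Phi> (k - 1) y * (1 / real n)" by (intro mult_right_mono) auto
  then have V: "Q ^ 24 * z ^ 4 \<le> V (k - 1) y" unfolding inverse_n[symmetric] by (simp add: V_def)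
  have "z ^ 8 = z ^ 28 * (Q ^ 24 * z ^ 4)"
  proof -
    have "z ^ 28 * (Q ^ 24 * z ^ 4) = (Q * z) ^ 24 * (z ^ 4 * z ^ 4)"
      unfolding power_mult_distrib by (simp flip: power_add)
    also have "\<dots> = z ^ 8" using Q by (simp add: z_def flip: power_add)
    finally show ?thesis ..
  qed
  also have "\<dots> \<le> w (k - 1) * V (k - 1) y"
    using w_last_le(2) V z_pos Q w_pos by (intro mult_mono) (auto intro: less_imp_le)
  also have "\<dots> \<le> S y" unfolding S_def using k w_pos V_nonneg
    by (intro member_le_sum[of "k - 1" _ "\<lambda>j. w j * V j y"]) (auto intro: mult_nonneg_nonneg less_imp_le)
  also have "\<dots> \<le> W y" using G_nonneg[of y] z_pos by (simp add: W_eq)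
  finally show ?thesis .
qed

end

section \<open>The process\<close>

lemma set_quantile_process:
  assumes "1 \<le> n" "h \<in> set_pmf (quantile_process n k \<delta> R t)" shows "set h \<subseteq> {1..n}"
  using assms(2)
proof (induction t arbitrary: h)
  case (Suc t)
  then obtain h' rk i where "h' \<in> set_pmf (quantile_process n k \<delta> R t)" 
    "i \<in> set_pmf (quantile_step n k \<delta> rk)" "h = i # h'" by auto
  then show ?case using Suc.IH[of h'] set_pmf_quantile_step[OF assms(1)] by fastforce
qed simp

text \<open>A step preserves the bound, (1 - e) B + \<eta> \<le> B. The step hypothesis is stated
  for each ranking separately, which disposes of randomised, history-dependent tie-breaking;
  nonnegative integrals avoid questions of integrability.\<close>

lemma nn_integral_quantile_process_le:
  assumes n: "1 \<le> n" and F: "\<And>h. 0 \<le> F h" and e: "0 \<le> e" "e \<le> 1" and B: "0 \<le> \<eta>" "\<eta> \<le> e * B" "F [] \<le> B"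
    and step: "\<And>h rk. set h \<subseteq> {1..n} \<Longrightarrow> rk \<in> set_pmf (R h) \<Longrightarrow>
      (\<Sum>i=1..n. pmf (quantile_step n k \<delta> rk) i * F (i # h)) \<le> (1 - e) * F h + \<eta>"
  shows "(\<integral>\<^sup>+h. ennreal (F h) \<partial>quantile_process n k \<delta> R t) \<le> ennreal B"
proof (induction t)
  case (Suc t)
  have "(\<integral>\<^sup>+h. ennreal (F h) \<partial>quantile_process n k \<delta> R (Suc t)) =
     (\<integral>\<^sup>+h. \<integral>\<^sup>+rk. \<integral>\<^sup>+i. ennreal (F (i # h)) \<partial>quantile_step n k \<delta> rk \<partial>R h \<partial>quantile_process n k \<delta> R t)"
    by (simp add: nn_integral_bind_pmf)
  also have "\<dots> \<le> (\<integral>\<^sup>+h. ennreal (1 - e) * ennreal (F h) + ennreal \<eta> \<partial>quantile_process n k \<delta> R t)"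
  proof (rule nn_integral_mono_AE, unfold AE_measure_pmf_iff, rule ballI)
    fix h assume "h \<in> set_pmf (quantile_process n k \<delta> R t)"
    then have h: "set h \<subseteq> {1..n}" by (rule set_quantile_process[OF n])
    have "(\<integral>\<^sup>+i. ennreal (F (i # h)) \<partial>quantile_step n k \<delta> rk) \<le> ennreal (1 - e) * ennreal (F h) + ennreal \<eta>"
      if rk: "rk \<in> set_pmf (R h)" for rk
    proof -
      have "(\<integral>\<^sup>+i. ennreal (F (i # h)) \<partial>quantile_step n k \<delta> rk) = 
          (\<Sum>i=1..n. ennreal (F (i # h)) * ennreal (pmf (quantile_step n k \<delta> rk) i))"
      proof (intro nn_integral_measure_pmf_support)
        show "ennreal (F (i # h)) = 0" if "i \<in> set_pmf (quantile_step n k \<delta> rk)" "i \<notin> {1..n}" for i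
          using set_pmf_quantile_step[OF n] that by blast
      qed auto
      also have "\<dots> = ennreal (\<Sum>i=1..n. pmf (quantile_step n k \<delta> rk) i * F (i # h))"
        using F by (subst sum_ennreal[symmetric]) (auto simp: ennreal_mult mult.commute)
      also have "\<dots> \<le> ennreal ((1 - e) * F h + \<eta>)" by (intro ennreal_leI step h rk)
      also have "\<dots> = ennreal (1 - e) * ennreal (F h) + ennreal \<eta>"
        using F e B by (simp add: ennreal_mult ennreal_plus)
      finally show ?thesis .
    qed
    then have "(\<integral>\<^sup>+rk. \<integral>\<^sup>+i. ennreal (F (i # h)) \<partial>quantile_step n k \<delta> rk \<partial>R h)
        \<le> (\<integral>\<^sup>+rk. ennreal (1 - e) * ennreal (F h) + ennreal \<eta> \<partial>R h)"
      by (intro nn_integral_mono_AE) (auto simp: AE_measure_pmf_iff)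
    then show "(\<integral>\<^sup>+rk. \<integral>\<^sup>+i. ennreal (F (i # h)) \<partial>quantile_step n k \<delta> rk \<partial>R h)
        \<le> ennreal (1 - e) * ennreal (F h) + ennreal \<eta>"
      by simp
  qed
  also have "\<dots> = ennreal (1 - e) * (\<integral>\<^sup>+h. ennreal (F h) \<partial>quantile_process n k \<delta> R t) + ennreal \<eta>"
    by (simp add: nn_integral_add nn_integral_cmult)
  also have "\<dots> \<le> ennreal (1 - e) * ennreal B + ennreal \<eta>"
    by (intro add_right_mono mult_left_mono Suc) auto
  also have "\<dots> = ennreal ((1 - e) * B + \<eta>)"
    using F[of "[]"] e B by (simp add: ennreal_mult ennreal_plus)
  also have "\<dots> \<le> ennreal B" using B by (intro ennreal_leI) (simp add: algebra_simps)
  finally show ?case .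
qed (use B in \<open>simp add: ennreal_leI\<close>)

definition load :: "nat \<Rightarrow> nat list \<Rightarrow> nat \<Rightarrow> real" where
  "load n h i = real (count_list h i) - real (length h) / real n"

lemma load_Nil: "load n [] = (\<lambda>_. 0)"
  by (simp add: load_def fun_eq_iff)

lemma load_Cons: "load n (i # h) = shift n (load n h) i"
  by (auto simp: load_def shift_def fun_eq_iff add_divide_distrib)

lemma sum_load:
  assumes "set h \<subseteq> {1..n}" "1 \<le> n" shows "(\<Sum>i=1..n. load n h i) = 0"
proof -
  have "(\<Sum>i=1..n. real (count_list h i)) = real (length h)"
    using sum_count_set[OF assms(1)] by (simp flip: of_nat_sum)
  then show ?thesis using assms by (simp add: load_def sum_subtractf)
qed

lemma gap_attained:
  assumes "1 \<le> n" obtains i where "i \<in> {1..n}" "gap n h = load n h i"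
proof -
  have "Max (count_list h ` {1..n}) \<in> count_list h ` {1..n}" using assms by (intro Max_in) auto
  then obtain i where "i \<in> {1..n}" "Max (count_list h ` {1..n}) = count_list h i" by auto
  then show ?thesis using that[of i] by (simp add: gap_def load_def)
qed

section \<open>The rounded quantiles and the tail bound\<close>

context large begin

definition c :: "nat \<Rightarrow> nat" where
  "c l = nat \<lceil>\<delta>_tilde n k l * real n\<rceil>"

lemma \<delta>_tilde_eq:
  assumes "l < k" shows "\<delta>_tilde n k l = exp (- (ln 2 / 2) * L ^ (k - l))"
proof -
  have "ln (real n) powr ((real k - real l) / real k) = (L powr real k) powr ((real k - real l) / real k)"
    using L by (simp add: ln_n powr_realpow)
  also have "\<dots> = L powr real (k - l)" using k assms by (simp add: powr_powr of_nat_diff)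
  also have "\<dots> = L ^ (k - l)" using L by (simp add: powr_realpow)
  finally show ?thesis using assms by (simp add: \<delta>_tilde_def powr_def)
qed

lemma \<delta>_tilde_pos: "0 < \<delta>_tilde n k l"
  by (simp add: \<delta>_tilde_def)

lemma round_up_eq: "round_up n (\<delta>_tilde n k l) = real (c l) / real n"
  using \<delta>_tilde_pos[of l] by (simp add: round_up_def c_def less_imp_le)

lemma c_bounds: "\<delta>_tilde n k l * real n \<le> real (c l)" "real (c l) \<le> \<delta>_tilde n k l * real n + 1"
proof -
  have "0 \<le> \<delta>_tilde n k l * real n" using \<delta>_tilde_pos[of l] by simp
  then show "\<delta>_tilde n k l * real n \<le> real (c l)" "real (c l) \<le> \<delta>_tilde n k l * real n + 1"
    unfolding c_def by linarith+
qed

lemma \<delta>_tilde_le: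
  assumes "l < k" shows "\<delta>_tilde n k l \<le> 1 / 1000"
proof -
  have "1 / 3 * L ^ (k - l) \<le> ln 2 / 2 * L ^ (k - l)"
    using ln2_ge_two_thirds Lpow_pos[of "k - l"] by (intro mult_right_mono) auto
  moreover have "10000 \<le> L ^ (k - l)" using Lpow_ge[of "k - l"] assms by simp
  ultimately have "999 \<le> ln 2 / 2 * L ^ (k - l)" by linarith
  then have "1000 \<le> exp (ln 2 / 2 * L ^ (k - l))"
    using exp_ge_add_one_self[of "ln 2 / 2 * L ^ (k - l)"] by linarith
  then show ?thesis unfolding \<delta>_tilde_eq[OF assms] by (simp add: exp_minus field_simps)
qed

lemma c_mono:
  assumes "l \<le> l'" "l' \<le> k" shows "c l \<le> c l'"
proof -
  have "\<delta>_tilde n k l \<le> \<delta>_tilde n k l'"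
  proof (cases "l' = k")
    case True
    then show ?thesis using \<delta>_tilde_le[of l] assms by (cases "l = k") (auto simp: \<delta>_tilde_def)
  next
    case False
    then have l: "l < k" "l' < k" using assms by auto
    have "L ^ (k - l') \<le> L ^ (k - l)" using assms by (intro Lpow_mono) auto
    then show ?thesis unfolding \<delta>_tilde_eq[OF l(1)] \<delta>_tilde_eq[OF l(2)] by simp
  qed
  then show ?thesis unfolding c_def by (intro nat_mono ceiling_mono mult_right_mono) auto
qed

lemma c_k: "n \<le> 2 * c k" "2 * c k \<le> n + 1"
proof -
  have "c k = nat \<lceil>real n / 2\<rceil>" by (simp add: c_def \<delta>_tilde_def)
  then show "n \<le> 2 * c k" "2 * c k \<le> n + 1" by linarith+
qed

lemma c_small: "100 * (c (k - 1) + c k) \<le> 51 * n"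
proof -
  have "\<delta>_tilde n k (k - 1) * real n \<le> 1 / 1000 * real n"
    using \<delta>_tilde_le[of "k - 1"] k by (intro mult_right_mono) auto
  then have "real (c (k - 1)) \<le> real n / 1000 + 1" using c_bounds(2)[of "k - 1"] by simp
  moreover have "2 * real (c k) \<le> real n + 1" using c_k(2) by linarith
  moreover have "10 ^ 8 \<le> real n" using ln_n_ge ln_less_self[of "real n"] n by linarith
  ultimately have "100 * (real (c (k - 1)) + real (c k)) \<le> 51 * real n" by simp
  then have "real (100 * (c (k - 1) + c k)) \<le> real (51 * n)" by simp
  then show ?thesis by (simp only: of_nat_le_iff)
qed

text \<open>Layer j is matched with the quantile of index k - j, whose size before rounding is
  2^(-L^j/2). Rounding up adds at most one bin, hence at most a factor 2, which explains 4/n instead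
  of 2/n.\<close>

lemma admissible_step:
  assumes rk: "is_ranking n (count_list h) rk" and h: "set h \<subseteq> {1..n}"
  shows "admissible (\<lambda>i. pmf (quantile_step n k (\<lambda>i. round_up n (\<delta>_tilde n k i)) rk) i) (load n h)"
proof -
  define \<delta> where "\<delta> = (\<lambda>i. round_up n (\<delta>_tilde n k i))"
  have n1: "1 \<le> n" using n by simp
  interpret quantiles n k \<delta> c rk "load n h"
  proof
    show "c k \<le> n" using c_k n1 by linarith
    show "rk i < rk j" if "i \<in> {1..n}" "j \<in> {1..n}" "load n h j < load n h i" for i j
      using rk that by (simp add: is_ranking_def load_def)
  qed (use n1 rk c_mono in \<open>auto simp: \<delta>_def round_up_eq is_ranking_def\<close>)
  have "admissible prob (load n h)"
    unfolding admissible_def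
  proof (intro conjI allI impI ballI)
    show "prob_vector n prob" by (rule prob_vector_prob)
    show "prob i \<le> 2 / n" if "i \<in> {1..n}" for i using that by (rule prob_le)
    show "\<exists>T i0. top_half n prob (load n h) T i0" by (intro top_half_prob k c_k c_small)
    show "(\<Sum>i=1..n. load n h i) = 0" by (intro sum_load h n1)
  next
    fix j z i
    let ?e = "exp (- (ln 2 / 2) * L ^ j)"
    assume *: "1 \<le> j \<and> j < k \<and> card {i\<in>{1..n}. z < load n h i} \<le> ?e * n" and i: "i \<in> {1..n}" "z < load n h i"
    have l: "k - j < k" "k - (k - j) = j" "1 \<le> k - j" using * by auto
    have \<delta>: "\<delta>_tilde n k (k - j) = ?e" using \<delta>_tilde_eq[OF l(1)] l(2) by simp
    have "real (card {i\<in>{1..n}. z < load n h i}) \<le> real (c (k - j))" using * c_bounds(1)[of "k - j"] unfolding \<delta> by linarith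
    then have "prob i \<le> 2 * real (c (k - j)) / (real n)\<^sup>2" using l i by (intro prob_le_level[of _ z]) auto
    also have "\<dots> \<le> 2 * (2 * ?e * n) / (real n)\<^sup>2"
    proof (intro divide_right_mono mult_left_mono)
      \<comment> \<open>The unrounded class size is at least 1, since (ln 2)/2 L^j \<le> L^k = ln n;
        therefore the ceiling at most doubles it.\<close>
      have "ln 2 / 2 * L ^ j \<le> 1 * L ^ j" using ln2_le_25_over_36 Lpow_pos[of j] by (intro mult_right_mono) auto
      also have "\<dots> \<le> ln (real n)" unfolding ln_n using * Lpow_mono[of j k] by simp
      finally have "0 \<le> ln (real n) - ln 2 / 2 * L ^ j" by simp
      then have "1 \<le> exp (ln (real n) - ln 2 / 2 * L ^ j)" by simp
      also have "\<dots> = exp (- (ln 2 / 2) * L ^ j + ln (real n))" by simp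
      also have "\<dots> = ?e * n" unfolding exp_add using n by simp
      finally show "real (c (k - j)) \<le> 2 * ?e * n" using c_bounds(2)[of "k - j"] unfolding \<delta> by linarith
    qed auto
    also have "\<dots> = 4 / n * ?e" using n by (simp add: power2_eq_square)
    finally show "prob i \<le> 4 / n * ?e" .
  qed
  moreover have "prob = pmf (quantile_step n k \<delta> rk)" by (simp add: prob_def fun_eq_iff)
  ultimately show ?thesis by (simp add: \<delta>_def)
qed

text \<open>The mean of \<open>W\<close> stays below 2 z^22 = 2 n^(-11/2), and a large gap needs W
  \<ge> z^8 = n^(-2). Markov's inequality leaves 2 z^14 \<le> z^12 = n^(-3).\<close>

lemma prob_gap_le:
  assumes R: "ranking_rule n R"
  shows "1 - real n powr (- 3) \<le> measure_pmf.prob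
     (quantile_process n k (\<lambda>i. round_up n (\<delta>_tilde n k i)) R m) {h. gap n h \<le> 1000 * real k * L}"
proof -
  let ?P = "quantile_process n k (\<lambda>i. round_up n (\<delta>_tilde n k i)) R m"
  let ?A = "{h. gap n h \<le> 1000 * real k * L}"
  have n1: "1 \<le> n" using n by simp
  have zz: "0 \<le> z ^ m" for m using z_pos by simp
  have bound: "(\<integral>\<^sup>+h. ennreal (W (load n h)) \<partial>?P) \<le> ennreal (2 * z ^ 22)"
  proof (rule nn_integral_quantile_process_le[OF n1, where e = "z ^ 4 / 100000" and \<eta> = "z ^ 28"])
    show "0 \<le> z ^ 4 / 100000" "0 \<le> z ^ 28" using zz by simp_all
    show "z ^ 4 / 100000 \<le> 1" by (rule rate)
    \<comment> \<open>The equilibrium value 100000 z^24 of the recursion is rounded up to 2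
      z^22.\<close>
    have "z ^ 28 = (z * z) * z ^ 26" using power_add[of z 2 26] by (simp add: power2_eq_square)
    also have "\<dots> \<le> (1 / 10 ^ 16 * (1 / 10 ^ 16)) * z ^ 26" 
      using z_pos z_le by (intro mult_right_mono mult_mono) auto
    also have "\<dots> \<le> 2 / 100000 * z ^ 26" using zz by (intro mult_right_mono) auto
    also have "\<dots> = z ^ 4 / 100000 * (2 * z ^ 22)" by (simp flip: power_add)
    finally show "z ^ 28 \<le> z ^ 4 / 100000 * (2 * z ^ 22)" .
    show "W (load n []) \<le> 2 * z ^ 22" unfolding load_Nil using W_start zz[of 22] by linarith
  next
    fix h rk assume h: "set h \<subseteq> {1..n}" and rk: "rk \<in> set_pmf (R h)"
    then have "is_ranking n (count_list h) rk" using R by (auto simp: ranking_rule_def)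
    from W_drift[OF admissible_step[OF this h]]
    show "(\<Sum>i=1..n. pmf (quantile_step n k (\<lambda>i. round_up n (\<delta>_tilde n k i)) rk) i * W (load n (i # h)))
       \<le> (1 - z ^ 4 / 100000) * W (load n h) + z ^ 28"
      by (simp add: load_Cons)
  qed (rule W_nonneg)
  have large_gap: "z ^ 8 \<le> W (load n h)" if "h \<notin> ?A" for h
  proof -
    obtain i where "i \<in> {1..n}" "gap n h = load n h i" using gap_attained[OF n1] .
    then show ?thesis using that by (intro W_large) auto
  qed
  have "ennreal (z ^ 8 * measure_pmf.prob ?P (- ?A)) = (\<integral>\<^sup>+h. ennreal (z ^ 8) * indicator (- ?A) h \<partial>?P)"
    using zz by (simp add: nn_integral_cmult measure_pmf.emeasure_eq_measure ennreal_mult)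
  also have "\<dots> \<le> (\<integral>\<^sup>+h. ennreal (W (load n h)) \<partial>?P)"
    using large_gap by (intro nn_integral_mono) (auto simp: indicator_def ennreal_leI)
  also have "\<dots> \<le> ennreal (2 * z ^ 22)" by (rule bound)
  finally have "z ^ 8 * measure_pmf.prob ?P (- ?A) \<le> 2 * z ^ 22" using zz[of 22] by (simp add: ennreal_le_iff)
  also have "\<dots> \<le> 1000 * z ^ 21" using z_mono[of 21 22] zz[of 21] by linarith
  also have "\<dots> \<le> z ^ 20" by (rule z_less) simp
  also have "\<dots> = z ^ 8 * z ^ 12" by (simp flip: power_add)
  finally have "measure_pmf.prob ?P (- ?A) \<le> z ^ 12"
    using z_pos by (simp only: mult_le_cancel_left_pos zero_less_power)
  also have "z ^ 12 = (z ^ 4) ^ 3" by (simp flip: power_mult)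
  also have "\<dots> = real n powr (- 3)"
    unfolding inverse_n[symmetric] using n by (simp add: powr_minus power_inverse divide_inverse)
  finally have "measure_pmf.prob ?P (- ?A) \<le> real n powr (- 3)" .
  moreover have "measure_pmf.prob ?P (- ?A) = 1 - measure_pmf.prob ?P ?A"
    using measure_pmf.prob_compl[of ?A ?P] by (simp add: Compl_eq_Diff_UNIV)
  ultimately show ?thesis by simp
qed

end

text \<open>k \<le> \<kappa> ln ln n amounts to (ln n)^(1/k) \<ge> 10^4, so 15 L^(k-1) \<le>
  15/10000 ln n. The other factors are exp (O((ln ln n)^2)) because k \<le> ln ln n; for ln ln n
  \<ge> 200 everything fits below n^(1/4).\<close>

lemma large_exists:
  fixes n k :: nat
  assumes n: "exp (exp 200) \<le> real n" and k: "2 \<le> k" "real k \<le> \<kappa> * ln (ln (real n))"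
  shows "\<exists>Q N. large n k (ln (real n) powr (1 / real k)) Q N"
proof -
  define s where "s = ln (ln (real n))"
  define L where "L = ln (real n) powr (1 / real k)"
  define N where "N = 4 * 10 ^ 8 * ln (real n)"
  define Q where "Q = exp (ln (real n) / 4)"
  have n0: "0 < real n" using n exp_gt_zero[of "exp 200"] by linarith
  have ln_n: "exp 200 \<le> ln (real n)" using n n0 by (simp add: ln_ge_iff)
  then have lnpos: "0 < ln (real n)" using exp_gt_zero[of "200"] by linarith
  have s: "200 \<le> s" unfolding s_def using ln_n lnpos by (simp add: ln_ge_iff)
  have es: "exp s = ln (real n)" using lnpos by (simp add: s_def)
  have k0: "0 < real k" using k by simp
  have ln4: "1 \<le> ln (10 ^ 4 :: real)" using exp_le by (simp add: ln_ge_iff)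
  have kln: "real k * ln (10 ^ 4) \<le> s" using k(2) ln4 by (simp add: \<kappa>_def s_def field_simps)
  have L: "10 ^ 4 \<le> L"
  proof -
    have "ln (10 ^ 4 :: real) \<le> s / real k" using kln k0 by (simp add: pos_le_divide_eq mult.commute)
    then have "exp (ln (10 ^ 4 :: real)) \<le> exp (s / real k)" by (simp only: exp_le_cancel_iff)
    moreover have "exp (s / real k) = L" using lnpos by (simp add: L_def powr_def s_def)
    ultimately show ?thesis by simp
  qed
  have Lk: "ln (real n) = L ^ k"
  proof -
    have "L ^ k = L powr real k" using L by (subst powr_realpow) auto
    also have "\<dots> = ln (real n)" using k0 lnpos by (simp add: L_def powr_powr)
    finally show ?thesis ..
  qed
  have ks: "real k \<le> s"
  proof -
    have "real k * 1 \<le> real k * ln (10 ^ 4)" using ln4 k0 by (intro mult_left_mono) auto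
    with kln show ?thesis by linarith
  qed
  have "real k * N ^ k * exp (15 * L ^ (k - 1)) \<le> exp s * exp (s * (29 + s)) * exp (15 / 10000 * exp s)"
  proof (intro mult_mono)
    show "real k \<le> exp s" using ks exp_ge_add_one_self[of s] by linarith
    have "(4 * 10 ^ 8 :: real) \<le> 2 ^ 29" by simp
    also have "\<dots> \<le> exp 1 ^ 29" using exp_ge_add_one_self[of "1::real"] by (intro power_mono) auto
    also have "\<dots> = exp 29" by (simp flip: exp_of_nat_mult)
    finally have "N \<le> exp 29 * exp s" unfolding N_def es using lnpos by (intro mult_right_mono) auto
    then have "N ^ k \<le> exp (29 + s) ^ k" using lnpos by (intro power_mono) (auto simp: N_def exp_add)
    also have "\<dots> = exp (real k * (29 + s))" by (simp only: exp_of_nat_mult)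
    also have "\<dots> \<le> exp (s * (29 + s))" using ks s by (simp add: mult_right_mono)
    finally show "N ^ k \<le> exp (s * (29 + s))" .
    have "10 ^ 4 * L ^ (k - 1) \<le> L * L ^ (k - 1)" using L by (intro mult_right_mono) auto
    also have "\<dots> = exp s" unfolding es Lk using k by (simp flip: power_Suc)
    finally show "exp (15 * L ^ (k - 1)) \<le> exp (15 / 10000 * exp s)" by simp
  qed (use lnpos in \<open>auto simp: N_def\<close>)
  also have "\<dots> \<le> Q"
  proof -
    \<comment> \<open>With ln n = exp s, a quadratic polynomial in s has to be compared with exp s;
      the cubic lower bound of exp s suffices when s \<ge> 200.\<close>
    have "(s / 3) ^ 3 \<le> (1 + s / 3) ^ 3" using s by (intro power_mono) auto
    also have "\<dots> \<le> exp s" using exp_ge_one_plus_x_over_n_power_n[of 3 s] s by simp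
    finally have cube: "s * s\<^sup>2 \<le> 27 * exp s" by (simp add: power3_eq_cube power2_eq_square field_simps)
    have "200 * s\<^sup>2 \<le> s * s\<^sup>2" using s by (intro mult_right_mono) auto
    with cube have "200 * s\<^sup>2 \<le> 27 * exp s" by (rule order_trans[rotated])
    moreover have "200 * s \<le> s\<^sup>2" unfolding power2_eq_square using s by (intro mult_right_mono) auto
    moreover have "s + s * (29 + s) = 30 * s + s\<^sup>2" by (simp add: power2_eq_square algebra_simps)
    moreover have "0 < exp s" by simp
    ultimately have "s + s * (29 + s) + 15 / 10000 * exp s \<le> exp s / 4" by linarith
    then show ?thesis unfolding Q_def es[symmetric] exp_add[symmetric] by simp
  qed
  finally have "real k * N ^ k * exp (15 * L ^ (k - 1)) \<le> Q" .
  moreover have "Q ^ 4 = real n" using n0 by (simp add: Q_def flip: exp_of_nat_mult)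
  ultimately have "large n k L Q N"
    using k L Lk n0 by unfold_locales (auto simp: N_def Q_def)
  then show ?thesis unfolding L_def by blast
qed

theorem theorem6p1:
  "\<exists>n\<^sub>0::nat. \<forall>n\<ge>n\<^sub>0. \<forall>k::nat. 2 \<le> k \<and> real k \<le> \<kappa> * ln (ln (real n)) \<longrightarrow>
     (\<forall>R. ranking_rule n R \<longrightarrow>
       (\<forall>m\<ge>1. measure_pmf.prob
            (quantile_process n k (\<lambda>i. round_up n (\<delta>_tilde n k i)) R m)
            {h. gap n h \<le> 1000 * real k * ln (real n) powr (1 / real k)}
          \<ge> 1 - real n powr (- 3)))"
proof (intro exI[of _ "nat \<lceil>exp (exp (200 :: real))\<rceil>"] allI impI)
  fix n k :: nat and R and m :: nat
  assume n: "nat \<lceil>exp (exp (200 :: real))\<rceil> \<le> n" and k: "2 \<le> k \<and> real k \<le> \<kappa> * ln (ln (real n))"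
    and R: "ranking_rule n R"
  have "exp (exp 200) \<le> real n" using n by (simp add: nat_ceiling_le_eq)
  then obtain Q N where "large n k (ln (real n) powr (1 / real k)) Q N" using large_exists k by blast
  then show "1 - real n powr (- 3) \<le> measure_pmf.prob
            (quantile_process n k (\<lambda>i. round_up n (\<delta>_tilde n k i)) R m)
            {h. gap n h \<le> 1000 * real k * ln (real n) powr (1 / real k)}"
    using R by (rule large.prob_gap_le)
qed

end
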